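(* Let $K\ge 2$, $v\in(0,1]$ and $u>0$. There are constants $C>0$ depending only on $u,v$, and $T_0$ depending only on $K,u,v$, such that for every $\epsilon\in(0,1]$, every $T\ge T_0$ and every $K$-armed heavy-tailed bandit instance (with $(1+v)$-th raw moments bounded by $u$), the DP Robust Successive Elimination algorithm (defined in the context), run for $T$ rounds with parameters $\epsilon,v,u$ and confidence $\beta=\frac1T$, satisfies the following two bounds on its expected regret. (Instance-dependent bound) $$\mathcal R_T\le C\left(\frac{u^{\frac1{1+v}}}{\epsilon}\sum_{a:\Delta_a>0}\bigl(\log T+\ell(\Delta_a)\bigr)\Bigl(\frac1{\Delta_a}\Bigr)^{\frac1v}+\max_a\Delta_a\right),$$ where $\ell(\Delta)=\log\log\max\{e,1/\Delta\}$. (Instance-independent bound) $$\mathcal R_T\le C\,u^{\frac{v}{(1+v)^2}}\left(\frac{K\log T}{\epsilon}\right)^{\frac{v}{1+v}}T^{\frac1{1+v}}.$$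
   Context: Bandit setting. There are $K$ arms. Pulling arm $a$ yields an independent reward from an unknown distribution $\mathcal X_a$ on $\mathbb R$ with mean $\mu_a$. In each round $t=1,\dots,T$ the learner pulls an arm $a_t\in[K]$ and observes a reward $x_t\sim\mathcal X_{a_t}$. Heavy-tailed assumption: $\mathbb E_{X\sim\mathcal X_a}[|X|^{1+v}]\le u$ for every arm $a$. The values $v\in(0,1]$ and $u>0$ are known constants. Let $\mu^*=\max_a\mu_a$ and $\Delta_a=\mu^*-\mu_a$. The expected regret is $\mathcal R_T=T\mu^*-\mathbb E[\sum_{t=1}^T x_t]$, where the expectation is over all randomness. $\log$ is the natural logarithm. $\mathrm{Lap}(\lambda)$ is the Laplace distribution with density $\frac1{2\lambda}e^{-|x|/\lambda}$. DP Robust Successive Elimination (inputs $\beta,\epsilon,v,u$, horizon $T$). Start with the viable set $\mathcal S=[K]$. For epochs $\tau=1,2,\dots$, until $|\mathcal S|=1$ (the procedure is stopped in any case after $T$ pulls): - Set $L_\tau=\log(4|\mathcal S|\tau^2/\beta)$, $D_\tau=2^{-\tau}$, $R_\tau=\left\lceil u^{1/v}\frac{24^{(1+v)/v}L_\tau}{\epsilon D_\tau^{(1+v)/v}}+1\right\rceil$ and $B_\tau=\left(\frac{uR_\tau\epsilon}{L_\tau}\right)^{1/(1+v)}$. - Pull each $a\in\mathcal S$ exactly $R_\tau$ times (cycling through $\mathcal S$), getting fresh rewards $x_{a,1},\dots,x_{a,R_\tau}$. Truncate them as $\widetilde x_{a,r}=x_{a,r}\mathbb I_{\{|x_{a,r}|\le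 B_\tau\}}$. - Set $\bar\mu_a=\frac1{R_\tau}\sum_{r=1}^{R_\tau}\widetilde x_{a,r}$ and $\widetilde\mu_a=\bar\mu_a+\mathrm{Lap}\left(\frac{2B_\tau}{R_\tau\epsilon}\right)$, with independent noises. - Set $err_\tau=u^{1/(1+v)}\left(\frac{L_\tau}{R_\tau\epsilon}\right)^{v/(1+v)}$ and remove from $\mathcal S$ every arm $a$ with $\max_{a'\in\mathcal S}\widetilde\mu_{a'}-\widetilde\mu_a>12\,err_\tau$. Once $|\mathcal S|=1$, pull the remaining arm in all remaining rounds. *)

theory Defs
  imports "HOL-Probability.Probability"
begin

text \<open>Arms are the numbers \<open>a < K\<close>, rounds are \<open>t = 1, 2, \<dots>\<close> and epochs are \<open>\<tau> = 1, 2, \<dots>\<close>.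
  An instance \<open>X\<close> assigns to every arm its reward distribution.\<close>

definition heavy_tailed_bandit :: "nat \<Rightarrow> real \<Rightarrow> real \<Rightarrow> (nat \<Rightarrow> real measure) \<Rightarrow> bool" where
  "heavy_tailed_bandit K v u X \<longleftrightarrow>
     (\<forall>a<K. real_distribution (X a) \<and>
        integrable (X a) (\<lambda>x. \<bar>x\<bar> powr (1 + v)) \<and>
        (\<integral>x. \<bar>x\<bar> powr (1 + v) \<partial>X a) \<le> u)"

definition arm_mean :: "(nat \<Rightarrow> real measure) \<Rightarrow> nat \<Rightarrow> real" where
  "arm_mean X a = (\<integral>x. x \<partial>X a)"

definition best_mean :: "nat \<Rightarrow> (nat \<Rightarrow> real measure) \<Rightarrow> real" where
  "best_mean K X = Max (arm_mean X ` {..<K})"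

definition gap :: "nat \<Rightarrow> (nat \<Rightarrow> real measure) \<Rightarrow> nat \<Rightarrow> real" where
  "gap K X a = best_mean K X - arm_mean X a"

definition laplace :: "real \<Rightarrow> real measure" where
  "laplace b = density lborel (\<lambda>x. ennreal (1 / (2 * b) * exp (- \<bar>x\<bar> / b)))"


subsection \<open>Parameters of an epoch\<close>

text \<open>The quantities \<open>L\<^sub>\<tau>\<close>, \<open>D\<^sub>\<tau>\<close>, \<open>R\<^sub>\<tau>\<close>, \<open>B\<^sub>\<tau>\<close>, \<open>err\<^sub>\<tau>\<close> and the scale of the noise depend on the
  past only through the number \<open>m\<close> of arms that are viable in epoch \<open>\<tau>\<close>.\<close>

definition epoch_L :: "real \<Rightarrow> nat \<Rightarrow> nat \<Rightarrow> real" where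
  "epoch_L \<beta> \<tau> m = ln (4 * real m * (real \<tau>)\<^sup>2 / \<beta>)"

definition epoch_D :: "nat \<Rightarrow> real" where
  "epoch_D \<tau> = 2 powr (- real \<tau>)"

definition epoch_R :: "real \<Rightarrow> real \<Rightarrow> real \<Rightarrow> real \<Rightarrow> nat \<Rightarrow> nat \<Rightarrow> nat" where
  "epoch_R v u \<epsilon> \<beta> \<tau> m =
     nat \<lceil>u powr (1 / v) * (24 powr ((1 + v) / v) * epoch_L \<beta> \<tau> m /
            (\<epsilon> * epoch_D \<tau> powr ((1 + v) / v))) + 1\<rceil>"

definition epoch_B :: "real \<Rightarrow> real \<Rightarrow> real \<Rightarrow> real \<Rightarrow> nat \<Rightarrow> nat \<Rightarrow> real" where
  "epoch_B v u \<epsilon> \<beta> \<tau> m =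
     (u * real (epoch_R v u \<epsilon> \<beta> \<tau> m) * \<epsilon> / epoch_L \<beta> \<tau> m) powr (1 / (1 + v))"

definition epoch_err :: "real \<Rightarrow> real \<Rightarrow> real \<Rightarrow> real \<Rightarrow> nat \<Rightarrow> nat \<Rightarrow> real" where
  "epoch_err v u \<epsilon> \<beta> \<tau> m =
     u powr (1 / (1 + v)) *
     (epoch_L \<beta> \<tau> m / (real (epoch_R v u \<epsilon> \<beta> \<tau> m) * \<epsilon>)) powr (v / (1 + v))"

definition noise_scale :: "real \<Rightarrow> real \<Rightarrow> real \<Rightarrow> real \<Rightarrow> nat \<Rightarrow> nat \<Rightarrow> real" where
  "noise_scale v u \<epsilon> \<beta> \<tau> m =
     2 * epoch_B v u \<epsilon> \<beta> \<tau> m / (real (epoch_R v u \<epsilon> \<beta> \<tau> m) * \<epsilon>)"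


subsection \<open>Randomness\<close>

text \<open>A sample point is a pair \<open>(x, z)\<close> of tables with independent entries: \<open>x (t, a) \<sim> X a\<close> is the
  reward that is observed if arm \<open>a\<close> is pulled in round \<open>t\<close>, and \<open>z (\<tau>, m, a)\<close> is the noise that is
  added for arm \<open>a\<close> in epoch \<open>\<tau>\<close> if \<open>m\<close> arms are viable in that epoch. Along a run, at most one
  \<open>a\<close> per \<open>t\<close> and one \<open>m\<close> per \<open>\<tau>\<close> is ever looked up, so every reward and every noise in use is a
  fresh independent draw from the prescribed distribution.\<close>

type_synonym sample = "(nat \<times> nat \<Rightarrow> real) \<times> (nat \<times> nat \<times> nat \<Rightarrow> real)"

definition sample_space ::
    "nat \<Rightarrow> real \<Rightarrow> real \<Rightarrow> real \<Rightarrow> real \<Rightarrow> (nat \<Rightarrow> real measure) \<Rightarrow> sample measure" where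
  "sample_space K v u \<epsilon> \<beta> X =
     (\<Pi>\<^sub>M (t, a) \<in> {1..} \<times> {..<K}. X a) \<Otimes>\<^sub>M
     (\<Pi>\<^sub>M (\<tau>, m, a) \<in> {1..} \<times> {1..K} \<times> {..<K}. laplace (noise_scale v u \<epsilon> \<beta> \<tau> m))"


subsection \<open>The algorithm\<close>

text \<open>The arm pulled in round \<open>t > s\<close> when \<open>S\<close> is cycled through in increasing order, starting in
  round \<open>s + 1\<close>.\<close>

definition cycle_arm :: "nat set \<Rightarrow> nat \<Rightarrow> nat \<Rightarrow> nat" where
  "cycle_arm S s t = sorted_list_of_set S ! ((t - s - 1) mod card S)"

text \<open>In the following two definitions, \<open>S\<close> is the viable set of epoch \<open>\<tau>\<close> and \<open>s\<close> is the number of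
  pulls before that epoch.\<close>

definition private_mean ::
    "real \<Rightarrow> real \<Rightarrow> real \<Rightarrow> real \<Rightarrow> sample \<Rightarrow> nat \<Rightarrow> nat set \<Rightarrow> nat \<Rightarrow> nat \<Rightarrow> real" where
  "private_mean v u \<epsilon> \<beta> \<omega> \<tau> S s a =
     (let R = epoch_R v u \<epsilon> \<beta> \<tau> (card S); B = epoch_B v u \<epsilon> \<beta> \<tau> (card S) in
      (\<Sum>t | t \<in> {s<..s + card S * R} \<and> cycle_arm S s t = a.
          fst \<omega> (t, a) * indicator {y. \<bar>y\<bar> \<le> B} (fst \<omega> (t, a))) / real R
      + snd \<omega> (\<tau>, card S, a))"

definition eliminate ::
    "real \<Rightarrow> real \<Rightarrow> real \<Rightarrow> real \<Rightarrow> sample \<Rightarrow> nat \<Rightarrow> nat set \<Rightarrow> nat \<Rightarrow> nat set" where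
  "eliminate v u \<epsilon> \<beta> \<omega> \<tau> S s =
     S - {a \<in> S. Max (private_mean v u \<epsilon> \<beta> \<omega> \<tau> S s ` S) - private_mean v u \<epsilon> \<beta> \<omega> \<tau> S s a
                  > 12 * epoch_err v u \<epsilon> \<beta> \<tau> (card S)}"

text \<open>The viable set and the number of pulls after \<open>n\<close> epochs. The horizon does not occur here: no
  decision is made within an epoch, so an epoch that is cut off by the horizon affects no
  arm pulled up to the horizon.\<close>

primrec epoch_state ::
    "nat \<Rightarrow> real \<Rightarrow> real \<Rightarrow> real \<Rightarrow> real \<Rightarrow> sample \<Rightarrow> nat \<Rightarrow> nat set \<times> nat" where
  "epoch_state K v u \<epsilon> \<beta> \<omega> 0 = ({..<K}, 0)"
| "epoch_state K v u \<epsilon> \<beta> \<omega> (Suc n) =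
     (let (S, s) = epoch_state K v u \<epsilon> \<beta> \<omega> n in
      if card S = 1 then (S, s)
      else (eliminate v u \<epsilon> \<beta> \<omega> (Suc n) S s, s + card S * epoch_R v u \<epsilon> \<beta> (Suc n) (card S)))"

text \<open>The least \<open>n\<close> below is the number of epochs completed before round \<open>t\<close>. If only one arm is
  viable by then, cycling through the viable set means pulling this arm forever.\<close>

definition pulled_arm ::
    "nat \<Rightarrow> real \<Rightarrow> real \<Rightarrow> real \<Rightarrow> real \<Rightarrow> sample \<Rightarrow> nat \<Rightarrow> nat" where
  "pulled_arm K v u \<epsilon> \<beta> \<omega> t =
     (let n = (LEAST n. card (fst (epoch_state K v u \<epsilon> \<beta> \<omega> n)) = 1 \<or>
                        t \<le> snd (epoch_state K v u \<epsilon> \<beta> \<omega> (Suc n)));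
          (S, s) = epoch_state K v u \<epsilon> \<beta> \<omega> n
      in cycle_arm S s t)"

definition observed_reward ::
    "nat \<Rightarrow> real \<Rightarrow> real \<Rightarrow> real \<Rightarrow> real \<Rightarrow> sample \<Rightarrow> nat \<Rightarrow> real" where
  "observed_reward K v u \<epsilon> \<beta> \<omega> t = fst \<omega> (t, pulled_arm K v u \<epsilon> \<beta> \<omega> t)"

definition expected_regret ::
    "nat \<Rightarrow> real \<Rightarrow> real \<Rightarrow> real \<Rightarrow> real \<Rightarrow> (nat \<Rightarrow> real measure) \<Rightarrow> nat \<Rightarrow> real" where
  "expected_regret K v u \<epsilon> \<beta> X T =
     real T * best_mean K X -
     (\<integral>\<omega>. (\<Sum>t=1..T. observed_reward K v u \<epsilon> \<beta> \<omega> t) \<partial>sample_space K v u \<epsilon> \<beta> X)"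

definition loglog_gap :: "real \<Rightarrow> real" where
  "loglog_gap \<Delta> = ln (ln (max (exp 1) (1 / \<Delta>)))"

end

theory Submission
  imports Defs
begin

text \<open>The truncation level makes \<open>err\<^sub>\<tau> = u B\<^sub>\<tau>\<^sup>-\<^sup>v = B\<^sub>\<tau> L\<^sub>\<tau> / (R\<^sub>\<tau> \<epsilon>)\<close>. Hence the bias of a truncated mean is at
  most \<open>err\<^sub>\<tau>\<close>, the Chernoff bound with the fixed exponent \<open>1 / B\<^sub>\<tau>\<close> gives a deviation of at most
  \<open>2 err\<^sub>\<tau>\<close>, and the Laplace noise is at most \<open>2 err\<^sub>\<tau>\<close>, each up to probability of order
  \<open>exp (- L\<^sub>\<tau>)\<close>. The data of an epoch are independent of the state in which the epoch starts, so
  conditioning on this state costs nothing, and a union bound over arms and epochs shows that,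
  outside an event of probability at most \<open>3 \<beta>\<close>, every private mean is within \<open>6 err\<^sub>\<tau>\<close> of the true mean.
  Then a best arm always survives, and an arm that survives epoch \<open>\<tau>\<close> has a gap of at most
  \<open>24 err\<^sub>\<tau> \<le> 2\<^sup>-\<^sup>\<tau>\<close>. Summing the geometrically growing \<open>R\<^sub>\<tau>\<close> bounds the number of pulls of each arm. The
  second bound follows by splitting the arms at the gap \<open>\<theta> = (K log T / (\<epsilon> T))\<^sup>v\<^sup>/\<^sup>(\<^sup>1\<^sup>+\<^sup>v\<^sup>)\<close>.\<close>

section \<open>The Laplace distribution\<close>

text \<open>The obstacle is that an epoch starts from a random state: its viable set and its first
  round depend on the past, so the rounds in which an arm is sampled are not fixed in advance. For
  each fixed pair (S, s), however, the event that the epoch starts in (S, s) is decided by the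
  rewards up to round s and the noises of earlier epochs, while the data of an epoch started there
  are later rewards and the noises of that epoch. Disjoint blocks of table entries are independent,
  and the pairs, being countably many, can be summed. The same principle, applied to the choice of
  the arm in round t and the rewards of round t, turns the regret into an expected sum of gaps. The
  run is analysed without a horizon, so the union bound ranges over all epochs, and the square of
  \<tau> inside L makes it summable. An arm of gap d survives for about log (1 / d) epochs, so the
  term log \<tau> of L is what becomes the iterated logarithm. Since C may depend on u, it absorbs
  all powers of u and the bound 2 (1 + u) on the gaps.\<close>

lemma distr_uminus_laplace:
  "distr (laplace b) borel uminus = laplace b"
proof -
  have "laplace b = density lborel (\<lambda>x. ennreal (1 / (2 * b) * exp (- \<bar>x\<bar> / b)))"
    by (simp add: laplace_def)
  also have "\<dots> = density (distr lborel borel uminus) (\<lambda>x. ennreal (1 / (2 * b) * exp (- \<bar>x\<bar> / b)))"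
    by (simp add: lborel_distr_uminus)
  also have "\<dots> = distr (density lborel (\<lambda>x. ennreal (1 / (2 * b) * exp (- \<bar>- x\<bar> / b)))) borel uminus"
    by (subst density_distr) auto
  finally show ?thesis by (simp add: laplace_def)
qed

lemma sets_laplace [simp, measurable_cong]: "sets (laplace b) = sets borel"
  by (simp add: laplace_def)

lemma space_laplace [simp]: "space (laplace b) = UNIV"
  by (simp add: laplace_def)

lemma laplace_upper_tail:
  assumes "0 < b" "0 \<le> c"
  shows "emeasure (laplace b) {c..} = ennreal (exp (- c / b) / 2)"
proof -
  let ?F = "\<lambda>x. - exp (- x / b) / 2"
  have "emeasure (laplace b) {c..} =
      (\<integral>\<^sup>+x. ennreal (1 / (2 * b) * exp (- \<bar>x\<bar> / b)) * indicator {c..} x \<partial>lborel)"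
    unfolding laplace_def by (subst emeasure_density) auto
  also have "\<dots> = (\<integral>\<^sup>+x. ennreal (1 / (2 * b) * exp (- x / b)) * indicator {c..} x \<partial>lborel)"
    using assms by (intro nn_integral_cong) (auto simp: indicator_def)
  also have "\<dots> = ennreal (0 - ?F c)"
  proof (rule nn_integral_FTC_atLeast)
    have "filterlim (\<lambda>x. x / b) at_top at_top"
      using filterlim_tendsto_pos_mult_at_top[of "\<lambda>_. 1 / b" "1 / b" at_top "\<lambda>x. x"] assms
      by (simp add: filterlim_ident)
    then have "filterlim (\<lambda>x. - x / b) at_bot at_top"
      by (simp add: filterlim_uminus_at_top)
    then have "((\<lambda>x. exp (- x / b)) \<longlongrightarrow> 0) at_top"
      by (rule filterlim_compose[OF exp_at_bot])
    from tendsto_divide[OF tendsto_minus[OF this] tendsto_const[of 2]]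
    show "(?F \<longlongrightarrow> 0) at_top" by simp
    show "DERIV ?F x :> 1 / (2 * b) * exp (- x / b)" for x
      using assms by (auto intro!: derivative_eq_intros simp: field_simps)
  qed (use assms in auto)
  finally show ?thesis by simp
qed

lemma laplace_lower_tail:
  assumes "0 < b" "0 \<le> c"
  shows "emeasure (laplace b) {.. - c} = ennreal (exp (- c / b) / 2)"
proof -
  have "emeasure (laplace b) {.. - c} = emeasure (distr (laplace b) borel uminus) {.. - c}"
    by (simp add: distr_uminus_laplace)
  also have "\<dots> = emeasure (laplace b) {c..}"
  proof (subst emeasure_distr)
    have "uminus -` {.. - c} \<inter> space (laplace b) = {c..}" by auto
    then show "emeasure (laplace b) (uminus -` {.. - c} \<inter> space (laplace b)) = emeasure (laplace b) {c..}"
      by simp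
  qed auto
  finally show ?thesis using laplace_upper_tail[OF assms] by simp
qed

lemma laplace_tail:
  assumes "0 < b" "0 < c"
  shows "emeasure (laplace b) {z. c \<le> \<bar>z\<bar>} = ennreal (exp (- c / b))"
proof -
  have "{z::real. c \<le> \<bar>z\<bar>} = {c..} \<union> {.. - c}" by auto
  then have "emeasure (laplace b) {z. c \<le> \<bar>z\<bar>} = emeasure (laplace b) {c..} + emeasure (laplace b) {.. - c}"
    using assms by (auto intro!: plus_emeasure[symmetric])
  then show ?thesis
    using assms by (simp add: laplace_upper_tail laplace_lower_tail flip: ennreal_plus)
qed

text \<open>The tail formulas at 0 give mass 1/2 on each side. The origin, a null set, is removed
  from one side to make the union disjoint.\<close>

lemma prob_space_laplace:
  assumes "0 < b"
  shows "prob_space (laplace b)"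
proof
  have eq: "space (laplace b) = {0..} \<union> ({.. - 0} - {0::real})" by auto
  have z: "emeasure (laplace b) {0::real} = 0"
    unfolding laplace_def
    by (subst emeasure_density) (auto simp: nn_integral_0_iff_AE intro!: AE_I[where N="{0}"] split: split_indicator)
  have "emeasure (laplace b) ({.. - 0} - {0}) = emeasure (laplace b) {.. - 0}"
    by (rule emeasure_Diff_null_set) (use z in \<open>auto simp: null_sets_def\<close>)
  moreover have "emeasure (laplace b) ({0..} \<union> ({.. - 0} - {0})) =
      emeasure (laplace b) {0..} + emeasure (laplace b) ({.. - 0} - {0})"
    by (intro plus_emeasure[symmetric]) auto
  ultimately show "emeasure (laplace b) (space (laplace b)) = 1"
    unfolding eq using laplace_upper_tail[OF assms, of 0] laplace_lower_tail[OF assms, of 0]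
    by (simp flip: ennreal_plus add: ennreal_1[symmetric] del: ennreal_1 ennreal_half)
qed

section \<open>The parameters of an epoch\<close>

lemma powr_epoch_D: "epoch_D \<tau> powr q = 1 / (2 powr q) ^ \<tau>"
  by (simp add: epoch_D_def powr_minus_divide powr_power powr_powr powr_divide mult.commute)

locale dp_rse =
  fixes K :: nat and v u \<epsilon> \<beta> :: real and X :: "nat \<Rightarrow> real measure"
  assumes K_pos: "0 < K" and v_pos: "0 < v" and v_le: "v \<le> 1" and u_pos: "0 < u"
    and \<epsilon>_pos: "0 < \<epsilon>" and \<epsilon>_le: "\<epsilon> \<le> 1" and \<beta>_pos: "0 < \<beta>" and \<beta>_le: "\<beta> \<le> 1"
    and heavy_tailed: "heavy_tailed_bandit K v u X"
begin

abbreviation "L \<equiv> epoch_L \<beta>"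
abbreviation "R \<equiv> epoch_R v u \<epsilon> \<beta>"
abbreviation "B \<equiv> epoch_B v u \<epsilon> \<beta>"
abbreviation "err \<equiv> epoch_err v u \<epsilon> \<beta>"
abbreviation "nscale \<equiv> noise_scale v u \<epsilon> \<beta>"
abbreviation "state \<equiv> epoch_state K v u \<epsilon> \<beta>"

text \<open>Here the 4 inside L matters: it exceeds e, and \<beta> \<le> 1. The bound later lets
  additive constants be absorbed into L.\<close>

lemma L_ge_1:
  assumes "1 \<le> \<tau>" "1 \<le> m"
  shows "1 \<le> L \<tau> m"
proof -
  have "1 * 1 \<le> real m * (real \<tau>)\<^sup>2"
    using assms by (intro mult_mono) auto
  then have "4 * 1 \<le> 4 * real m * (real \<tau>)\<^sup>2"
    by simp
  then have "4 * 1 / 1 \<le> 4 * real m * (real \<tau>)\<^sup>2 / \<beta>"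
    using \<beta>_pos \<beta>_le by (intro frac_le) auto
  then have "exp 1 \<le> 4 * real m * (real \<tau>)\<^sup>2 / \<beta>"
    using exp_le by linarith
  then show ?thesis
    unfolding epoch_L_def by (subst ln_ge_iff) (auto intro: less_le_trans[OF exp_gt_zero])
qed

lemma
  assumes "1 \<le> \<tau>" "1 \<le> m"
  shows R_lower: "u powr (1 / v) * 24 powr ((1 + v) / v) * L \<tau> m * (2 powr ((1 + v) / v)) ^ \<tau> / \<epsilon> \<le> R \<tau> m"
    and R_upper: "R \<tau> m \<le> u powr (1 / v) * 24 powr ((1 + v) / v) * L \<tau> m * (2 powr ((1 + v) / v)) ^ \<tau> / \<epsilon> + 2"
    and R_ge_1: "1 \<le> R \<tau> m"
proof -
  define x where "x = u powr (1 / v) * 24 powr ((1 + v) / v) * L \<tau> m * (2 powr ((1 + v) / v)) ^ \<tau> / \<epsilon>"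
  have x: "0 \<le> x"
    using L_ge_1[OF assms] \<epsilon>_pos by (simp add: x_def)
  have "R \<tau> m = nat \<lceil>x + 1\<rceil>"
    by (simp add: epoch_R_def x_def powr_epoch_D mult_ac)
  then have R: "real (R \<tau> m) = real_of_int \<lceil>x + 1\<rceil>"
    using x by simp
  have "x + 1 \<le> R \<tau> m" "R \<tau> m \<le> x + 2"
    unfolding R by linarith+
  then show "x \<le> R \<tau> m" "R \<tau> m \<le> x + 2" "1 \<le> R \<tau> m"
    using x by linarith+
qed

text \<open>All quantities are monomials in q = u R \<epsilon> / L, the power 1 + v of B. The choice
  of B balances the bias against the deviation. \<open>R_div_B\<close> evaluates the moment term of
  the Chernoff exponent, and \<open>nscale_mult_L\<close> says that 2 err is exactly L noise scales,
  so that the Laplace tail there is exp (- L).\<close>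

lemma
  assumes "1 \<le> \<tau>" "1 \<le> m"
  shows B_pos: "0 < B \<tau> m"
    and u_div_B: "u * B \<tau> m powr (- v) = err \<tau> m"
    and R_div_B: "real (R \<tau> m) * u * B \<tau> m powr (- 1 - v) = L \<tau> m / \<epsilon>"
    and B_mult_L: "B \<tau> m * L \<tau> m / (real (R \<tau> m) * \<epsilon>) = err \<tau> m"
    and nscale_mult_L: "nscale \<tau> m * L \<tau> m = 2 * err \<tau> m"
    and nscale_pos: "0 < nscale \<tau> m"
    and err_pos: "0 < err \<tau> m"
proof -
  define q where "q = u * real (R \<tau> m) * \<epsilon> / L \<tau> m"
  have L: "0 < L \<tau> m" and R: "0 < real (R \<tau> m)"
    using L_ge_1[OF assms] R_ge_1[OF assms] by linarith+
  have q: "0 < q"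
    using L R u_pos \<epsilon>_pos by (simp add: q_def)
  have B: "B \<tau> m = q powr (1 / (1 + v))"
    by (simp add: epoch_B_def q_def)
  show Bp: "0 < B \<tau> m" using q by (simp add: B)
  have Lq: "L \<tau> m / (real (R \<tau> m) * \<epsilon>) = u / q"
    using L R u_pos \<epsilon>_pos by (simp add: q_def)
  have "1 / (1 + v) + v / (1 + v) = 1"
    using v_pos by (simp add: field_simps)
  then have "u powr (1 / (1 + v)) * u powr (v / (1 + v)) = u"
    using u_pos by (simp flip: powr_add)
  then have "err \<tau> m = u * q powr (- (v / (1 + v)))"
    using u_pos q by (simp add: epoch_err_def Lq powr_divide powr_minus_divide)
  then show e: "u * B \<tau> m powr (- v) = err \<tau> m"
    using q by (simp add: B powr_powr)
  have Bq: "B \<tau> m powr (- 1 - v) = 1 / q"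
  proof -
    have "1 / (1 + v) * (- 1 - v) = - 1"
      using v_pos by (simp add: field_simps)
    then show ?thesis
      unfolding B powr_powr using q by (simp add: powr_minus_divide)
  qed
  show "real (R \<tau> m) * u * B \<tau> m powr (- 1 - v) = L \<tau> m / \<epsilon>"
    unfolding Bq using L R u_pos \<epsilon>_pos by (simp add: q_def)
  have "B \<tau> m * (1 / q) = B \<tau> m powr (- v)"
    unfolding Bq[symmetric] using Bp by (simp add: powr_mult_base)
  then show BL: "B \<tau> m * L \<tau> m / (real (R \<tau> m) * \<epsilon>) = err \<tau> m"
    using Lq e by (metis times_divide_eq_right mult.commute mult.assoc mult_1)
  show "nscale \<tau> m * L \<tau> m = 2 * err \<tau> m"
    by (simp add: noise_scale_def flip: BL)
  show "0 < nscale \<tau> m"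
    using Bp R \<epsilon>_pos by (simp add: noise_scale_def)
  show "0 < err \<tau> m"
    using e u_pos Bp by (simp flip: e)
qed

text \<open>The constant 24 in R is made for this: with p = (1 + v) / v, err contains the power 1 /
  p of L / (R \<epsilon>), and taking this power in the lower bound for R extracts exactly 24 and
  \<open>2 ^ \<tau>\<close>.\<close>

lemma err_le_epoch_D:
  assumes "1 \<le> \<tau>" "1 \<le> m"
  shows "24 * err \<tau> m \<le> 1 / 2 ^ \<tau>"
proof -
  define p where "p = (1 + v) / v"
  have L: "0 < L \<tau> m" and R: "0 < real (R \<tau> m)"
    using L_ge_1[OF assms] R_ge_1[OF assms] by linarith+
  have p: "0 < p" "1 / v * (1 / p) = 1 / (1 + v)" "v / (1 + v) = 1 / p" "p * (1 / p) = 1"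
    using v_pos by (auto simp: p_def)
  have "u powr (1 / v) * 24 powr p * L \<tau> m * (2 powr p) ^ \<tau> / \<epsilon> \<le> R \<tau> m"
    using R_lower[OF assms] by (simp add: p_def)
  then have "u powr (1 / v) * 24 powr p * (2 powr p) ^ \<tau> * (L \<tau> m / (real (R \<tau> m) * \<epsilon>)) \<le> 1"
    using R \<epsilon>_pos by (simp add: field_simps)
  then have "(u powr (1 / v) * 24 powr p * (2 powr p) ^ \<tau> * (L \<tau> m / (real (R \<tau> m) * \<epsilon>))) powr (1 / p) \<le> 1"
    using p L R \<epsilon>_pos u_pos by (intro powr_le1) auto
  moreover have "(u powr (1 / v) * 24 powr p * (2 powr p) ^ \<tau> * (L \<tau> m / (real (R \<tau> m) * \<epsilon>))) powr (1 / p)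
     = u powr (1 / (1 + v)) * 24 * 2 ^ \<tau> * (L \<tau> m / (real (R \<tau> m) * \<epsilon>)) powr (1 / p)"
  proof -
    have "((2 powr p) ^ \<tau>) powr (1 / p) = (2::real) ^ \<tau>"
      using p by (simp add: powr_power powr_powr powr_realpow)
    moreover have "(24 powr p) powr (1 / p) = (24::real)"
      using p by (simp add: powr_powr)
    moreover have "(u powr (1 / v)) powr (1 / p) = u powr (1 / (1 + v))"
      using p by (simp add: powr_powr del: powr_powr[symmetric])
    ultimately show ?thesis
      using L R \<epsilon>_pos u_pos by (simp add: powr_mult powr_divide)
  qed
  ultimately have "24 * err \<tau> m * 2 ^ \<tau> \<le> 1"
    by (simp add: epoch_err_def p(3) mult_ac)
  then show ?thesis by (simp add: field_simps)
qed

end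

section \<open>Independence of the entries of two random tables\<close>

text \<open>Merges both tables into one family over the sum type, so that the joint independence of
  rewards and noises becomes a single statement.\<close>

definition coordinate :: "'i + 'j \<Rightarrow> ('i \<Rightarrow> 'c) \<times> ('j \<Rightarrow> 'c) \<Rightarrow> 'c" where
  "coordinate i \<omega> = case_sum (fst \<omega>) (snd \<omega>) i"

lemma coordinate_simps [simp]:
  "coordinate (Inl i) \<omega> = fst \<omega> i" "coordinate (Inr j) \<omega> = snd \<omega> j"
  by (simp_all add: coordinate_def)

locale two_products =
  fixes I :: "'i set" and J :: "'j set" and M :: "'i \<Rightarrow> real measure" and N :: "'j \<Rightarrow> real measure"
  assumes prob_M: "\<And>i. i \<in> I \<Longrightarrow> prob_space (M i)" and prob_N: "\<And>j. j \<in> J \<Longrightarrow> prob_space (N j)"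
    and sets_M: "\<And>i. i \<in> I \<Longrightarrow> sets (M i) = sets borel"
    and sets_N: "\<And>j. j \<in> J \<Longrightarrow> sets (N j) = sets borel"
begin

abbreviation "PP \<equiv> PiM I M \<Otimes>\<^sub>M PiM J N"

lemma prob_space_PP: "prob_space PP"
proof -
  interpret M: prob_space "PiM I M" by (rule prob_space_PiM) (rule prob_M)
  interpret N: prob_space "PiM J N" by (rule prob_space_PiM) (rule prob_N)
  interpret pair_prob_space "PiM I M" "PiM J N" ..
  show ?thesis by (rule prob_space_axioms)
qed

lemma measurable_coordinate:
  assumes "k \<in> I <+> J"
  shows "coordinate k \<in> borel_measurable PP"
proof -
  have "(\<lambda>\<omega>. fst \<omega> i) \<in> borel_measurable PP" if "i \<in> I" for i
  proof -
    have "(\<lambda>\<omega>. fst \<omega> i) \<in> measurable PP (M i)"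
      using that by (intro measurable_compose[OF measurable_fst measurable_component_singleton])
    then show ?thesis using sets_M[OF that] by (simp cong: measurable_cong_sets)
  qed
  moreover have "(\<lambda>\<omega>. snd \<omega> j) \<in> borel_measurable PP" if "j \<in> J" for j
  proof -
    have "(\<lambda>\<omega>. snd \<omega> j) \<in> measurable PP (N j)"
      using that by (intro measurable_compose[OF measurable_snd measurable_component_singleton])
    then show ?thesis using sets_N[OF that] by (simp cong: measurable_cong_sets)
  qed
  ultimately show ?thesis
    using assms by (auto simp: coordinate_def[abs_def])
qed

text \<open>A finite subset of the sum type splits into two index sets, so the cylinder is a
  rectangle and its measure a product of two known cylinder measures. Both the marginals and the
  independence of the coordinates are read off from this formula.\<close>

lemma emeasure_cylinder:
  assumes F: "finite F" "F \<subseteq> I <+> J" and A: "\<And>k. k \<in> F \<Longrightarrow> A k \<in> sets borel"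
  shows "emeasure PP {\<omega> \<in> space PP. \<forall>k\<in>F. coordinate k \<omega> \<in> A k} =
    (\<Prod>k\<in>F. emeasure (case_sum M N k) (A k))"
proof -
  interpret M: prob_space "PiM I M" by (rule prob_space_PiM) (rule prob_M)
  interpret N: prob_space "PiM J N" by (rule prob_space_PiM) (rule prob_N)
  interpret pair_prob_space "PiM I M" "PiM J N" ..
  define F1 F2 where "F1 = Inl -` F" and "F2 = Inr -` F"
  have F12: "F = F1 <+> F2"
    by (simp add: set_eq_iff F1_def F2_def split_sum_all Plus_def image_iff)
  have fin: "finite F1" "finite F2" and sub: "F1 \<subseteq> I" "F2 \<subseteq> J"
    using F by (auto simp: F12 finite_Plus_iff)
  let ?E1 = "prod_emb I M F1 (\<Pi>\<^sub>E i\<in>F1. A (Inl i))" and ?E2 = "prod_emb J N F2 (\<Pi>\<^sub>E j\<in>F2. A (Inr j))"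
  have A1: "A (Inl i) \<in> sets (M i)" if "i \<in> F1" for i
    using A[of "Inl i"] that sub sets_M[of i] by (auto simp: F1_def)
  have A2: "A (Inr j) \<in> sets (N j)" if "j \<in> F2" for j
    using A[of "Inr j"] that sub sets_N[of j] by (auto simp: F2_def)
  have "{\<omega> \<in> space PP. \<forall>k\<in>F. coordinate k \<omega> \<in> A k} = ?E1 \<times> ?E2"
    by (auto simp: Ball_def split_sum_all F1_def F2_def space_pair_measure prod_emb_def space_PiM PiE_iff)
  also have "emeasure PP \<dots> = emeasure (PiM I M) ?E1 * emeasure (PiM J N) ?E2"
    using A1 A2 sub fin by (intro N.emeasure_pair_measure_Times sets_PiM_I) auto
  also have "emeasure (PiM I M) ?E1 = (\<Prod>i\<in>F1. emeasure (M i) (A (Inl i)))"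
    using A1 sub fin prob_M by (intro emeasure_PiM_emb) auto
  also have "emeasure (PiM J N) ?E2 = (\<Prod>j\<in>F2. emeasure (N j) (A (Inr j)))"
    using A2 sub fin prob_N by (intro emeasure_PiM_emb) auto
  also have "(\<Prod>i\<in>F1. emeasure (M i) (A (Inl i))) * (\<Prod>j\<in>F2. emeasure (N j) (A (Inr j))) =
      (\<Prod>k\<in>F. emeasure (case_sum M N k) (A k))"
    using fin by (simp add: F12 prod.Plus)
  finally show ?thesis .
qed

lemma distr_coordinate:
  assumes "k \<in> I <+> J"
  shows "distr PP borel (coordinate k) = case_sum M N k"
proof (rule measure_eqI)
  show "sets (distr PP borel (coordinate k)) = sets (case_sum M N k)"
    using assms sets_M sets_N by auto
  fix A assume "A \<in> sets (distr PP borel (coordinate k))"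
  then have A: "A \<in> sets borel" by simp
  have "emeasure (distr PP borel (coordinate k)) A = emeasure PP {\<omega> \<in> space PP. \<forall>k\<in>{k}. coordinate k \<omega> \<in> A}"
    using A measurable_coordinate[OF assms] by (auto simp: emeasure_distr intro!: arg_cong2[where f=emeasure])
  also have "\<dots> = emeasure (case_sum M N k) A"
    using emeasure_cylinder[of "{k}" "\<lambda>_. A"] assms A by auto
  finally show "emeasure (distr PP borel (coordinate k)) A = emeasure (case_sum M N k) A" .
qed

lemma indep_coordinates: "prob_space.indep_vars PP (\<lambda>_. borel) coordinate (I <+> J)"
proof -
  interpret prob_space PP by (rule prob_space_PP)
  show ?thesis
    unfolding indep_vars_def2
  proof (intro conjI ballI indep_setsI)
    fix A F
    assume F: "F \<noteq> {}" "F \<subseteq> I <+> J" "finite F"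
      and "\<forall>k\<in>F. A k \<in> {coordinate k -` B \<inter> space PP |B. B \<in> sets borel}"
    then obtain B where B: "\<And>k. k \<in> F \<Longrightarrow> B k \<in> sets borel"
      and AB: "\<And>k. k \<in> F \<Longrightarrow> A k = coordinate k -` B k \<inter> space PP"
      by simp metis
    \<comment> \<open>Each factor is itself a cylinder, over a single index, so one formula
      evaluates both sides of the product rule.\<close>
    have Ak: "A k = {\<omega> \<in> space PP. \<forall>k\<in>{k}. coordinate k \<omega> \<in> B k}" if "k \<in> F" for k
      using AB[OF that] by auto
    have "(\<Inter>k\<in>F. A k) = {\<omega> \<in> space PP. \<forall>k\<in>F. coordinate k \<omega> \<in> B k}"
      using AB F by auto
    then have "emeasure PP (\<Inter>k\<in>F. A k) = (\<Prod>k\<in>F. emeasure (case_sum M N k) (B k))"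
      using emeasure_cylinder[OF F(3,2) B] by simp
    also have "\<dots> = (\<Prod>k\<in>F. emeasure PP (A k))"
    proof (rule prod.cong)
      fix k assume "k \<in> F"
      then show "emeasure (case_sum M N k) (B k) = emeasure PP (A k)"
        using emeasure_cylinder[of "{k}" B] F B Ak[of k] by (auto simp: subset_iff)
    qed simp
    finally show "prob (\<Inter>k\<in>F. A k) = (\<Prod>k\<in>F. prob (A k))"
      by (simp add: emeasure_eq_measure prod_ennreal prod_nonneg)
  qed (auto intro!: measurable_coordinate measurable_sets)
qed

end

lemma (in prob_space) indep_var_disjoint_blocks:
  fixes Y :: "'k \<Rightarrow> 'a \<Rightarrow> real"
  assumes "indep_vars (\<lambda>_. borel) Y I" "A \<inter> B = {}" "A \<subseteq> I" "B \<subseteq> I"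
    and "f \<in> measurable (PiM A (\<lambda>_. borel)) N1" "g \<in> measurable (PiM B (\<lambda>_. borel)) N2"
  shows "indep_var N1 (\<lambda>\<omega>. f (\<lambda>k\<in>A. Y k \<omega>)) N2 (\<lambda>\<omega>. g (\<lambda>k\<in>B. Y k \<omega>))"
  using indep_var_compose[OF indep_var_restrict[OF assms(1-4)] assms(5,6)] by (simp add: comp_def)

section \<open>The states of a run\<close>

lemma cycle_arm_in:
  assumes "finite S" "S \<noteq> {}"
  shows "cycle_arm S s t \<in> S"
proof -
  have "(t - s - 1) mod card S < card S"
    using assms by (simp add: card_gt_0_iff)
  then show ?thesis
    unfolding cycle_arm_def using assms
    by (metis nth_mem length_sorted_list_of_set set_sorted_list_of_set)
qed

text \<open>If a has position j in the sorted list, then its rounds are s + 1 + i * card S + j with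
  i < r, one in each of the r complete cycles.\<close>

lemma card_cycle_rounds:
  assumes "finite S" "a \<in> S"
  shows "card {t \<in> {s<..s + card S * r}. cycle_arm S s t = a} = r"
proof -
  obtain j where j: "j < card S" "sorted_list_of_set S ! j = a"
    using assms by (metis in_set_conv_nth length_sorted_list_of_set set_sorted_list_of_set)
  let ?f = "\<lambda>i. s + 1 + i * card S + j"
  have "cycle_arm S s t = a \<longleftrightarrow> (t - s - 1) mod card S = j" for t
    unfolding cycle_arm_def j(2)[symmetric] using j
    by (subst nth_eq_iff_index_eq) auto
  moreover have "{t \<in> {s<..s + card S * r}. (t - s - 1) mod card S = j} = ?f ` {..<r}"
  proof (intro equalityI subsetI)
    fix t assume t: "t \<in> {t \<in> {s<..s + card S * r}. (t - s - 1) mod card S = j}"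
    define i where "i = (t - s - 1) div card S"
    have "t - s - 1 = i * card S + j"
      using t unfolding i_def by (metis (mono_tags, lifting) div_mult_mod_eq mem_Collect_eq)
    moreover have "i < r"
      unfolding i_def using t by (auto intro!: less_mult_imp_div_less simp: mult.commute)
    ultimately show "t \<in> ?f ` {..<r}"
      using t by (intro image_eqI[of _ _ i]) auto
  next
    fix t assume "t \<in> ?f ` {..<r}"
    then obtain i where i: "i < r" "t = ?f i" by auto
    have "i * card S + j < Suc i * card S" using j by simp
    also have "\<dots> \<le> r * card S" using i by (intro mult_le_mono1) simp
    finally show "t \<in> {t \<in> {s<..s + card S * r}. (t - s - 1) mod card S = j}"
      using i j by (auto simp: mult.commute)
  qed
  moreover have "inj_on ?f {..<r}"
    using j by (auto simp: inj_on_def)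
  ultimately show ?thesis
    by (simp add: card_image)
qed

context dp_rse
begin

text \<open>Nonempty, so that the largest private mean exists; finitely many, so that a run has only
  countably many possible states.\<close>

definition viable_sets :: "nat set set" where
  "viable_sets = Pow {..<K} - {{}}"

lemma viable_setsD:
  assumes "S \<in> viable_sets"
  shows "finite S" "S \<noteq> {}" "1 \<le> card S" "card S \<le> K" "a \<in> S \<Longrightarrow> a < K"
proof -
  show *: "finite S" "S \<noteq> {}" "a \<in> S \<Longrightarrow> a < K"
    using assms by (auto simp: viable_sets_def intro: finite_subset)
  then show "1 \<le> card S"
    by (metis One_nat_def Suc_leI card_gt_0_iff)
  have "card S \<le> card {..<K}"
    using assms by (intro card_mono) (auto simp: viable_sets_def)
  then show "card S \<le> K" by simp
qed

abbreviation "pmean \<equiv> private_mean v u \<epsilon> \<beta>"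
abbreviation "elim \<equiv> eliminate v u \<epsilon> \<beta>"

text \<open>The arm with the largest private mean survives, because err is positive.\<close>

lemma eliminate_viable:
  assumes "S \<in> viable_sets"
  shows "elim \<omega> (Suc n) S s \<in> viable_sets"
proof -
  let ?p = "pmean \<omega> (Suc n) S s"
  note S = viable_setsD[OF assms]
  have "Max (?p ` S) \<in> ?p ` S"
    using S by (intro Max_in) auto
  then obtain a where "a \<in> S" "Max (?p ` S) = ?p a" by auto
  moreover have "0 < err (Suc n) (card S)"
    using S by (intro err_pos) auto
  ultimately have "a \<in> elim \<omega> (Suc n) S s"
    by (simp add: eliminate_def)
  then show ?thesis
    using assms by (auto simp: viable_sets_def eliminate_def)
qed

lemma state_viable: "fst (state \<omega> n) \<in> viable_sets"
proof (induction n)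
  case 0
  then show ?case using K_pos by (auto simp: viable_sets_def)
next
  case (Suc n)
  then show ?case
    using eliminate_viable[of "fst (state \<omega> n)" \<omega> n "snd (state \<omega> n)"]
    by (auto simp: case_prod_beta Let_def)
qed

lemma snd_state_mono: "n \<le> n' \<Longrightarrow> snd (state \<omega> n) \<le> snd (state \<omega> n')"
  by (rule lift_Suc_mono_le[of "\<lambda>n. snd (state \<omega> n)"]) (auto simp: case_prod_beta Let_def)

lemma snd_state_Suc:
  "card (fst (state \<omega> n)) \<noteq> 1 \<Longrightarrow>
    snd (state \<omega> (Suc n)) = snd (state \<omega> n) + card (fst (state \<omega> n)) * R (Suc n) (card (fst (state \<omega> n)))"
  by (simp add: case_prod_beta Let_def)

text \<open>While more than one arm is viable, every epoch takes at least one round. Hence every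
  round is eventually reached.\<close>

lemma snd_state_ge:
  assumes "\<And>k. k < n \<Longrightarrow> card (fst (state \<omega> k)) \<noteq> 1"
  shows "n \<le> snd (state \<omega> n)"
  using assms
proof (induction n)
  case (Suc n)
  note S = viable_setsD[OF state_viable[of \<omega> n]]
  have "0 < R (Suc n) (card (fst (state \<omega> n)))"
    using R_ge_1[of "Suc n" "card (fst (state \<omega> n))"] S by simp
  with S have "0 < card (fst (state \<omega> n)) * R (Suc n) (card (fst (state \<omega> n)))"
    by simp
  moreover have "n \<le> snd (state \<omega> n)"
    using Suc by simp
  moreover have "snd (state \<omega> (Suc n)) =
      snd (state \<omega> n) + card (fst (state \<omega> n)) * R (Suc n) (card (fst (state \<omega> n)))"
    using Suc.prems[of n] by (intro snd_state_Suc) simp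
  ultimately show ?case by linarith
qed simp

definition settled :: "sample \<Rightarrow> nat \<Rightarrow> nat \<Rightarrow> bool" where
  "settled \<omega> t n \<longleftrightarrow> card (fst (state \<omega> n)) = 1 \<or> t \<le> snd (state \<omega> (Suc n))"

definition epochs_before :: "sample \<Rightarrow> nat \<Rightarrow> nat" where
  "epochs_before \<omega> t = (LEAST n. settled \<omega> t n)"

abbreviation "pulled \<equiv> pulled_arm K v u \<epsilon> \<beta>"

lemma pulled_arm_eq:
  "pulled \<omega> t = cycle_arm (fst (state \<omega> (epochs_before \<omega> t))) (snd (state \<omega> (epochs_before \<omega> t))) t"
  by (simp add: pulled_arm_def epochs_before_def settled_def case_prod_beta Let_def)

lemma settled_epochs_before: "settled \<omega> t (epochs_before \<omega> t)"
proof -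
  have "\<exists>n. settled \<omega> t n"
  proof (rule ccontr)
    assume *: "\<nexists>n. settled \<omega> t n"
    \<comment> \<open>After t + 1 epochs at least t + 1 pulls have been made, so t itself would be a
      witness.\<close>
    then have "Suc t \<le> snd (state \<omega> (Suc t))"
      by (intro snd_state_ge) (auto simp: settled_def)
    moreover have "\<not> settled \<omega> t t" using * by blast
    ultimately show False
      by (simp add: settled_def del: epoch_state.simps)
  qed
  then show ?thesis
    unfolding epochs_before_def by (rule LeastI_ex)
qed

lemma not_settled: "n < epochs_before \<omega> t \<Longrightarrow> \<not> settled \<omega> t n"
  unfolding epochs_before_def by (rule not_less_Least)

text \<open>By minimality the preceding epoch ended before round t. If there is none, no pull has
  been made, and t \<ge> 1 is what gives the strict inequality.\<close>

lemma snd_state_epochs_before: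
  assumes "1 \<le> t"
  shows "snd (state \<omega> (epochs_before \<omega> t)) < t"
proof (cases "epochs_before \<omega> t")
  case (Suc n)
  then have "\<not> settled \<omega> t n" by (intro not_settled) simp
  then show ?thesis unfolding Suc by (simp add: settled_def del: epoch_state.simps)
qed (use assms in simp)

lemma pulled_arm_viable: "pulled \<omega> t \<in> fst (state \<omega> (epochs_before \<omega> t))"
  unfolding pulled_arm_eq using viable_setsD[OF state_viable] by (intro cycle_arm_in) auto

lemma pulled_arm_less: "pulled \<omega> t < K"
  using viable_setsD(5)[OF state_viable pulled_arm_viable] .

section \<open>Which table entries a run depends on\<close>

definition agree :: "nat \<Rightarrow> nat \<Rightarrow> sample \<Rightarrow> sample \<Rightarrow> bool" where
  "agree s n \<omega> \<omega>' \<longleftrightarrow> (\<forall>t\<in>{1..s}. \<forall>a<K. fst \<omega> (t, a) = fst \<omega>' (t, a)) \<and>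
     (\<forall>\<tau>\<in>{1..n}. \<forall>m\<in>{1..K}. \<forall>a<K. snd \<omega> (\<tau>, m, a) = snd \<omega>' (\<tau>, m, a))"

lemma agree_mono: "agree s n \<omega> \<omega>' \<Longrightarrow> s' \<le> s \<Longrightarrow> n' \<le> n \<Longrightarrow> agree s' n' \<omega> \<omega>'"
  by (auto simp: agree_def)

lemma agree_sym: "agree s n \<omega> \<omega>' \<Longrightarrow> agree s n \<omega>' \<omega>"
  by (auto simp: agree_def)

lemma private_mean_cong:
  assumes "S \<in> viable_sets" "a \<in> S"
    and "\<And>t. t \<in> {s<..s + card S * R \<tau> (card S)} \<Longrightarrow> fst \<omega> (t, a) = fst \<omega>' (t, a)"
    and "snd \<omega> (\<tau>, card S, a) = snd \<omega>' (\<tau>, card S, a)"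
  shows "pmean \<omega> \<tau> S s a = pmean \<omega>' \<tau> S s a"
  unfolding private_mean_def Let_def using assms
  by (intro arg_cong2[where f="(+)"] arg_cong2[where f="(/)"] sum.cong) auto

lemma eliminate_cong:
  assumes "S \<in> viable_sets" and "agree (s + card S * R (Suc n) (card S)) (Suc n) \<omega> \<omega>'"
  shows "elim \<omega> (Suc n) S s = elim \<omega>' (Suc n) S s"
proof -
  have p: "pmean \<omega> (Suc n) S s a = pmean \<omega>' (Suc n) S s a" if "a \<in> S" for a
    using assms that viable_setsD[OF assms(1)]
    by (intro private_mean_cong) (auto simp: agree_def)
  then have "pmean \<omega> (Suc n) S s ` S = pmean \<omega>' (Suc n) S s ` S"
    by (intro image_cong) auto
  with p show ?thesis
    unfolding eliminate_def by auto
qed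

text \<open>The required amount of agreement is the number of pulls in the run itself, which behaves
  like a stopping time. Agreement up to the end of an epoch contains, by monotonicity, agreement up
  to its start.\<close>

lemma state_cong:
  assumes "agree (snd (state \<omega> n)) n \<omega> \<omega>'"
  shows "state \<omega>' n = state \<omega> n"
  using assms
proof (induction n)
  case (Suc n)
  have "agree (snd (state \<omega> n)) n \<omega> \<omega>'"
    using snd_state_mono[of n "Suc n" \<omega>] by (intro agree_mono[OF Suc.prems]) auto
  then have eq: "state \<omega>' n = state \<omega> n" by (rule Suc.IH)
  show ?case
  proof (cases "card (fst (state \<omega> n)) = 1")
    case False
    then have "elim \<omega> (Suc n) (fst (state \<omega> n)) (snd (state \<omega> n)) =
        elim \<omega>' (Suc n) (fst (state \<omega> n)) (snd (state \<omega> n))"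
      using Suc.prems snd_state_Suc[of \<omega> n] by (intro eliminate_cong state_viable) simp
    with eq False show ?thesis by (simp add: case_prod_beta Let_def)
  qed (simp add: eq case_prod_beta Let_def)
qed simp

text \<open>The length of an epoch is known at its start, so none of its data are needed to tell
  whether it reaches round t.\<close>

lemma settled_cong: "state \<omega>' n = state \<omega> n \<Longrightarrow> settled \<omega>' t n = settled \<omega> t n"
  by (simp add: settled_def case_prod_beta Let_def)

text \<open>All states up to the epoch of round t are reached with at most t - 1 pulls, so the
  rewards of round t have no influence. Agreement on the noises may be demanded for all epochs,
  because they are independent of every reward.\<close>

lemma pulled_arm_cong:
  assumes "1 \<le> t" "\<And>n. agree (t - 1) n \<omega> \<omega>'"
  shows "pulled \<omega>' t = pulled \<omega> t"
proof -
  have eq: "state \<omega>' n = state \<omega> n" if "n \<le> epochs_before \<omega> t" for n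
  proof -
    have "snd (state \<omega> n) \<le> t - 1"
      using snd_state_mono[OF that, of \<omega>] snd_state_epochs_before[OF assms(1), of \<omega>] by simp
    then show ?thesis
      by (intro state_cong agree_mono[OF assms(2)]) auto
  qed
  have "epochs_before \<omega>' t = epochs_before \<omega> t"
    unfolding epochs_before_def[of \<omega>']
  proof (rule Least_equality)
    show "settled \<omega>' t (epochs_before \<omega> t)"
      using settled_cong[OF eq[of "epochs_before \<omega> t"]] settled_epochs_before by simp
    show "epochs_before \<omega> t \<le> n" if "settled \<omega>' t n" for n
    proof (rule ccontr)
      assume "\<not> epochs_before \<omega> t \<le> n"
      then have "n < epochs_before \<omega> t" by simp
      with that show False
        using settled_cong[OF eq[of n]] not_settled[of n \<omega> t] by simp
    qed
  qed
  then show ?thesis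
    using eq[of "epochs_before \<omega> t"] by (simp add: pulled_arm_eq)
qed

section \<open>Measurability of the run\<close>

definition reward_index :: "(nat \<times> nat) set" where
  "reward_index = {1..} \<times> {..<K}"

definition noise_index :: "(nat \<times> nat \<times> nat) set" where
  "noise_index = {1..} \<times> {1..K} \<times> {..<K}"

text \<open>Stated for arbitrary maps into samples: besides the identity on the sample space, it is
  applied to samples rebuilt from a block of coordinates, as independence of functions of blocks
  demands.\<close>

definition measurable_sample :: "'b measure \<Rightarrow> ('b \<Rightarrow> sample) \<Rightarrow> bool" where
  "measurable_sample N h \<longleftrightarrow> (\<forall>k \<in> reward_index <+> noise_index. (\<lambda>x. coordinate k (h x)) \<in> borel_measurable N)"

lemma
  assumes "measurable_sample N h"
  shows measurable_reward: "1 \<le> t \<Longrightarrow> a < K \<Longrightarrow> (\<lambda>x. fst (h x) (t, a)) \<in> borel_measurable N"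
    and measurable_noise: "1 \<le> \<tau> \<Longrightarrow> 1 \<le> m \<Longrightarrow> m \<le> K \<Longrightarrow> a < K \<Longrightarrow> (\<lambda>x. snd (h x) (\<tau>, m, a)) \<in> borel_measurable N"
  using assms[unfolded measurable_sample_def, THEN bspec, of "Inl (t, a)"]
    assms[unfolded measurable_sample_def, THEN bspec, of "Inr (\<tau>, m, a)"]
  by (auto simp: reward_index_def noise_index_def Plus_def image_iff)

lemma measurable_private_mean:
  assumes h: "measurable_sample N h" and "S \<in> viable_sets" "a \<in> S" "1 \<le> \<tau>"
  shows "(\<lambda>x. pmean (h x) \<tau> S s a) \<in> borel_measurable N"
proof -
  note S = viable_setsD[OF assms(2)]
  have *: "(\<lambda>x. fst (h x) (t, a)) \<in> borel_measurable N" if "s < t" for t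
    using that S assms by (intro measurable_reward[OF h]) auto
  have [measurable]: "(\<lambda>x. fst (h x) (t, a) * indicator {y. \<bar>y\<bar> \<le> b} (fst (h x) (t, a))) \<in> borel_measurable N"
    if "s < t" for t b
    using *[OF that] by measurable
  have [measurable]: "(\<lambda>x. snd (h x) (\<tau>, card S, a)) \<in> borel_measurable N"
    using S assms by (intro measurable_noise[OF h]) auto
  show ?thesis
    unfolding private_mean_def Let_def
    by (intro borel_measurable_add borel_measurable_divide borel_measurable_sum borel_measurable_const) auto
qed

text \<open>The target is finite, so preimages of singletons suffice, and each is a finite Boolean
  combination of comparisons between private means.\<close>

lemma measurable_eliminate:
  assumes h: "measurable_sample N h" and S: "S \<in> viable_sets"
  shows "(\<lambda>x. elim (h x) (Suc n) S s) \<in> measurable N (count_space viable_sets)"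
proof (subst measurable_count_space_eq2)
  show fin: "finite viable_sets" by (simp add: viable_sets_def)
  have [measurable]: "(\<lambda>x. pmean (h x) (Suc n) S s a) \<in> borel_measurable N" if "a \<in> S" for a
    using that by (intro measurable_private_mean[OF h S]) auto
  have [measurable]: "(\<lambda>x. Max ((\<lambda>a. pmean (h x) (Suc n) S s a) ` S)) \<in> borel_measurable N"
    using viable_setsD[OF S] by (intro borel_measurable_Max) auto
  have [simp]: "finite S" using viable_setsD[OF S] by simp
  have "(\<lambda>x. elim (h x) (Suc n) S s) -` {S'} \<inter> space N \<in> sets N" for S'
  proof (cases "S' \<subseteq> S")
    case True
    then have "(\<lambda>x. elim (h x) (Suc n) S s) -` {S'} \<inter> space N =
      {x \<in> space N. \<forall>a\<in>S. a \<in> S' \<longleftrightarrow>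
        \<not> Max ((\<lambda>a. pmean (h x) (Suc n) S s a) ` S) - pmean (h x) (Suc n) S s a > 12 * err (Suc n) (card S)}"
      by (auto simp: eliminate_def)
    also have "\<dots> \<in> sets N" by measurable
    finally show ?thesis .
  next
    case False
    then have "(\<lambda>x. elim (h x) (Suc n) S s) -` {S'} \<inter> space N = {}"
      by (auto simp: eliminate_def)
    then show ?thesis by simp
  qed
  then show "(\<lambda>x. elim (h x) (Suc n) S s) \<in> space N \<rightarrow> viable_sets \<and>
      (\<forall>a\<in>viable_sets. (\<lambda>x. elim (h x) (Suc n) S s) -` {a} \<inter> space N \<in> sets N)"
    using eliminate_viable[OF S] by auto
qed

text \<open>For a fixed previous state the next one is measurable; countably many previous states
  are then glued together.\<close>

lemma measurable_state:
  assumes h: "measurable_sample N h"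
  shows "(\<lambda>x. state (h x) n) \<in> measurable N (count_space (viable_sets \<times> UNIV))"
proof (induction n)
  case 0
  have "{..<K} \<in> viable_sets" using K_pos by (auto simp: viable_sets_def)
  then show ?case by simp
next
  case (Suc n)
  have cnt: "countable (viable_sets \<times> (UNIV :: nat set))"
    by (intro countable_SIGMA) (auto simp: viable_sets_def intro: countable_finite)
  have "(\<lambda>x. (\<lambda>p x. case p of (S, s) \<Rightarrow> if card S = 1 then (S, s)
      else (elim (h x) (Suc n) S s, s + card S * R (Suc n) (card S))) (state (h x) n) x)
    \<in> measurable N (count_space (viable_sets \<times> UNIV))"
  proof (rule measurable_compose_countable'[OF _ Suc.IH cnt])
    fix p :: "nat set \<times> nat" assume "p \<in> viable_sets \<times> UNIV"
    then obtain S s where p: "p = (S, s)" "S \<in> viable_sets" by auto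
    show "(\<lambda>x. case p of (S, s) \<Rightarrow> if card S = 1 then (S, s)
        else (elim (h x) (Suc n) S s, s + card S * R (Suc n) (card S)))
      \<in> measurable N (count_space (viable_sets \<times> UNIV))"
    proof (cases "card S = 1")
      case False
      have "(\<lambda>S'. (S', s + card S * R (Suc n) (card S))) \<in>
          measurable (count_space viable_sets) (count_space (viable_sets \<times> UNIV))"
        by simp
      from measurable_compose[OF measurable_eliminate[OF h p(2)] this]
      show ?thesis using False by (simp add: p)
    qed (use p in simp)
  qed
  then show ?case by (simp add: case_prod_beta Let_def)
qed

lemma measurable_function_of_state:
  assumes h: "measurable_sample N h"
  shows "(\<lambda>x. f (state (h x) n)) \<in> measurable N (count_space UNIV)"
  by (rule measurable_compose[OF measurable_state[OF h]]) simp

lemma measurable_pulled_arm: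
  assumes h: "measurable_sample N h"
  shows "(\<lambda>x. pulled (h x) t) \<in> measurable N (count_space UNIV)"
proof -
  have [measurable]: "(\<lambda>x. settled (h x) t n) \<in> measurable N (count_space UNIV)" for n
    unfolding settled_def
    using measurable_function_of_state[OF h, of "\<lambda>S. card (fst S) = 1" n]
      measurable_function_of_state[OF h, of "\<lambda>S. t \<le> snd S" "Suc n"]
    by (intro pred_intros_logic)
  have n: "(\<lambda>x. epochs_before (h x) t) \<in> measurable N (count_space UNIV)"
    unfolding epochs_before_def by measurable
  show ?thesis
    unfolding pulled_arm_eq
    by (rule measurable_compose_countable'[OF _ n])
       (auto intro: measurable_function_of_state[OF h, of "\<lambda>S. cycle_arm (fst S) (snd S) t"])
qed

end

section \<open>Truncated heavy-tailed variables\<close>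

definition truncation :: "real \<Rightarrow> real \<Rightarrow> real" where
  "truncation b x = x * indicator {y. \<bar>y\<bar> \<le> b} x"

lemma borel_measurable_truncation [measurable]: "truncation b \<in> borel_measurable borel"
  unfolding truncation_def[abs_def] by measurable

lemma abs_truncation_le: "0 \<le> b \<Longrightarrow> \<bar>truncation b x\<bar> \<le> b"
  by (simp add: truncation_def indicator_def)

text \<open>For x = - y < 0 this follows from exp (- y) \<le> 1 / (1 + y), because (1 + y) times the
  right-hand side is 1 + y ^ 3.\<close>

lemma exp_le_quadratic:
  fixes x :: real
  assumes "\<bar>x\<bar> \<le> 1"
  shows "exp x \<le> 1 + x + x\<^sup>2"
proof (cases "0 \<le> x")
  case True
  then show ?thesis using exp_bound[of x] assms by simp
next
  case False
  define y where "y = - x"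
  have y: "0 < y" using False by (simp add: y_def)
  have "exp (- y) \<le> 1 / (1 + y)"
    using y exp_ge_add_one_self[of y] by (simp add: exp_minus divide_inverse)
  also have "\<dots> \<le> 1 - y + y\<^sup>2"
  proof -
    have "(1 + y) * (1 - y + y\<^sup>2) = 1 + y ^ 3" by algebra
    then show ?thesis using y by (simp add: divide_le_eq mult.commute)
  qed
  finally show ?thesis by (simp add: y_def)
qed

locale bounded_moment = real_distribution M for M +
  fixes v u :: real
  assumes v: "0 < v" "v \<le> 1"
    and moment_integrable: "integrable M (\<lambda>x. \<bar>x\<bar> powr (1 + v))"
    and moment_le: "(\<integral>x. \<bar>x\<bar> powr (1 + v) \<partial>M) \<le> u"
begin

text \<open>Source of the integrability of the rewards and of the bound 1 + u on the means.\<close>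

lemma abs_le_moment: "\<bar>x\<bar> \<le> 1 + \<bar>x\<bar> powr (1 + v)" for x :: real
proof (cases "\<bar>x\<bar> \<le> 1")
  case True
  then show ?thesis by (smt (verit) powr_ge_zero)
next
  case False
  then have "\<bar>x\<bar> powr 1 \<le> \<bar>x\<bar> powr (1 + v)"
    using v by (intro powr_mono) auto
  then show ?thesis using False by simp
qed

lemma integrable_id: "integrable M (\<lambda>x. x)"
proof (rule Bochner_Integration.integrable_bound[of M "\<lambda>x. 1 + \<bar>x\<bar> powr (1 + v)"])
  show "integrable M (\<lambda>x. 1 + \<bar>x\<bar> powr (1 + v))"
    using moment_integrable by auto
  show "AE x in M. norm x \<le> norm (1 + \<bar>x\<bar> powr (1 + v))"
    using abs_le_moment by (intro AE_I2) (smt (verit) real_norm_def)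
qed simp

lemma integrable_truncation:
  assumes "0 \<le> b"
  shows "integrable M (truncation b)"
  using abs_truncation_le[OF assms] by (intro integrable_const_bound[of _ b]) auto

text \<open>Where truncation changes x, the factor \<open>(\<bar>x\<bar> / b) powr v\<close> is at
  least 1; multiplying the error by it produces the moment.\<close>

lemma truncation_bias:
  assumes "0 < b"
  shows "\<bar>(\<integral>x. truncation b x \<partial>M) - (\<integral>x. x \<partial>M)\<bar> \<le> u * b powr (- v)"
proof -
  have "\<bar>truncation b x - x\<bar> \<le> \<bar>x\<bar> powr (1 + v) * b powr (- v)" for x
  proof (cases "\<bar>x\<bar> \<le> b")
    case False
    then have "1 \<le> (\<bar>x\<bar> / b) powr v"
      using assms v by (intro ge_one_powr_ge_zero) auto
    then have "\<bar>x\<bar> * 1 \<le> \<bar>x\<bar> * (\<bar>x\<bar> / b) powr v"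
      by (intro mult_left_mono) auto
    also have "\<dots> = \<bar>x\<bar> powr (1 + v) * b powr (- v)"
      using False assms by (simp add: powr_add powr_divide powr_minus_divide)
    finally show ?thesis using False by (simp add: truncation_def)
  qed (use assms in \<open>simp add: truncation_def\<close>)
  then have "(\<integral>x. \<bar>truncation b x - x\<bar> \<partial>M) \<le> (\<integral>x. \<bar>x\<bar> powr (1 + v) * b powr (- v) \<partial>M)"
    using assms integrable_id integrable_truncation[of b] moment_integrable by (intro integral_mono) auto
  also have "\<dots> \<le> u * b powr (- v)"
    using moment_le by (simp add: mult_right_mono)
  finally have "(\<integral>x. \<bar>truncation b x - x\<bar> \<partial>M) \<le> u * b powr (- v)" .
  moreover have "\<bar>(\<integral>x. truncation b x \<partial>M) - (\<integral>x. x \<partial>M)\<bar> \<le> (\<integral>x. \<bar>truncation b x - x\<bar> \<partial>M)"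
    using assms integrable_id integrable_truncation[of b] integral_abs_bound[of M "\<lambda>x. truncation b x - x"]
    by simp
  ultimately show ?thesis by linarith
qed

text \<open>The sign of \<sigma> covers both tails. Truncation keeps x / b in [-1, 1], where the
  exponential is at most a quadratic and the square is at most the power 1 + v. In this way the
  moment of order 1 + v does the work of a variance.\<close>

lemma truncation_exponential_moment:
  assumes "0 < b" "\<bar>\<sigma>\<bar> \<le> 1"
  shows "integrable M (\<lambda>x. exp (\<sigma> * truncation b x / b))"
    and "(\<integral>x. exp (\<sigma> * truncation b x / b) \<partial>M) \<le>
      exp (\<sigma> * (\<integral>x. truncation b x \<partial>M) / b + u * b powr (- 1 - v))"
proof -
  have le1: "\<bar>truncation b x / b\<bar> \<le> 1" for x
    using abs_truncation_le[of b x] assms by simp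
  have abs_le: "\<bar>\<sigma> * truncation b x / b\<bar> \<le> 1" for x
    using mult_mono[OF assms(2) le1[of x]] by (simp add: abs_mult)
  then have "exp (\<sigma> * truncation b x / b) \<le> exp 1" for x
    by (metis abs_le_D1 exp_le_cancel_iff)
  then show int: "integrable M (\<lambda>x. exp (\<sigma> * truncation b x / b))"
    by (intro integrable_const_bound[of _ "exp 1"]) auto
  have "exp (\<sigma> * truncation b x / b) \<le> 1 + \<sigma> / b * truncation b x + b powr (- 1 - v) * \<bar>x\<bar> powr (1 + v)" for x
  proof -
    have "(truncation b x / b)\<^sup>2 = \<bar>truncation b x / b\<bar> powr 2"
      by (metis abs_ge_zero power2_abs powr_numeral)
    also have "\<dots> \<le> \<bar>truncation b x / b\<bar> powr (1 + v)"
      using le1[of x] v by (intro powr_mono') auto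
    also have "\<dots> \<le> (\<bar>x\<bar> / b) powr (1 + v)"
      using v assms by (intro powr_mono2) (auto simp: truncation_def indicator_def divide_right_mono)
    also have "\<dots> = b powr (- 1 - v) * \<bar>x\<bar> powr (1 + v)"
      using assms by (simp add: powr_divide powr_minus_divide powr_diff powr_add field_simps)
    finally have 1: "(truncation b x / b)\<^sup>2 \<le> b powr (- 1 - v) * \<bar>x\<bar> powr (1 + v)" .
    have "(\<sigma> * truncation b x / b)\<^sup>2 = \<sigma>\<^sup>2 * (truncation b x / b)\<^sup>2"
      by (simp add: power_mult_distrib power_divide)
    also have "\<dots> \<le> 1 * (truncation b x / b)\<^sup>2"
      using assms by (intro mult_right_mono) (auto simp: abs_square_le_1)
    finally show ?thesis
      using exp_le_quadratic[OF abs_le[of x]] 1 by simp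
  qed
  then have "(\<integral>x. exp (\<sigma> * truncation b x / b) \<partial>M) \<le>
      (\<integral>x. 1 + \<sigma> / b * truncation b x + b powr (- 1 - v) * \<bar>x\<bar> powr (1 + v) \<partial>M)"
    using int integrable_truncation[of b] assms moment_integrable by (intro integral_mono) auto
  also have "\<dots> = 1 + (\<sigma> / b * (\<integral>x. truncation b x \<partial>M) + b powr (- 1 - v) * (\<integral>x. \<bar>x\<bar> powr (1 + v) \<partial>M))"
    using integrable_truncation[of b] assms moment_integrable prob_space by simp
  also have "\<dots> \<le> 1 + (\<sigma> / b * (\<integral>x. truncation b x \<partial>M) + b powr (- 1 - v) * u)"
    using moment_le by (intro add_left_mono mult_left_mono) auto
  also have "\<dots> \<le> exp (\<sigma> / b * (\<integral>x. truncation b x \<partial>M) + b powr (- 1 - v) * u)"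
    by (rule exp_ge_add_one_self)
  finally show "(\<integral>x. exp (\<sigma> * truncation b x / b) \<partial>M) \<le>
      exp (\<sigma> * (\<integral>x. truncation b x \<partial>M) / b + u * b powr (- 1 - v))"
    by (simp add: mult.commute)
qed

lemma abs_mean_le: "\<bar>\<integral>x. x \<partial>M\<bar> \<le> 1 + u"
proof -
  have "(\<integral>x. \<bar>x\<bar> \<partial>M) \<le> (\<integral>x. 1 + \<bar>x\<bar> powr (1 + v) \<partial>M)"
    using moment_integrable integrable_id abs_le_moment by (intro integral_mono) auto
  also have "\<dots> \<le> 1 + u"
    using moment_integrable moment_le prob_space by simp
  finally show ?thesis
    using integral_abs_bound[of M "\<lambda>x. x"] by linarith
qed

end

text \<open>Markov's inequality for the exponential of the sum; the Chernoff parameter is already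
  contained in Y.\<close>

lemma (in prob_space) chernoff_sum:
  fixes Y :: "'k \<Rightarrow> 'a \<Rightarrow> real"
  assumes "finite F" "indep_vars (\<lambda>_. borel) Y F"
    and int: "\<And>k. k \<in> F \<Longrightarrow> integrable M (\<lambda>\<omega>. exp (Y k \<omega>))"
    and le: "\<And>k. k \<in> F \<Longrightarrow> (\<integral>\<omega>. exp (Y k \<omega>) \<partial>M) \<le> exp c"
  shows "prob {\<omega> \<in> space M. y \<le> (\<Sum>k\<in>F. Y k \<omega>)} \<le> exp (real (card F) * c - y)"
proof -
  have ind: "indep_vars (\<lambda>_. borel) (\<lambda>k \<omega>. exp (Y k \<omega>)) F"
    by (rule indep_vars_compose2[OF assms(2)]) simp
  have "integrable M (\<lambda>\<omega>. \<Prod>k\<in>F. exp (Y k \<omega>))"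
    using assms(1) ind int by (rule indep_vars_integrable)
  then have I: "integrable M (\<lambda>\<omega>. exp (\<Sum>k\<in>F. Y k \<omega>))"
    using assms(1) by (simp add: exp_sum)
  have "(\<integral>\<omega>. exp (\<Sum>k\<in>F. Y k \<omega>) \<partial>M) = (\<Prod>k\<in>F. \<integral>\<omega>. exp (Y k \<omega>) \<partial>M)"
    using indep_vars_lebesgue_integral[OF assms(1) ind int] assms(1) by (simp add: exp_sum)
  also have "\<dots> \<le> (\<Prod>k\<in>F. exp c)"
    using le by (intro prod_mono) auto
  also have "\<dots> = exp (real (card F) * c)"
    by (simp add: exp_of_nat_mult)
  finally have E: "(\<integral>\<omega>. exp (\<Sum>k\<in>F. Y k \<omega>) \<partial>M) \<le> exp (real (card F) * c)" .
  have "{\<omega> \<in> space M. y \<le> (\<Sum>k\<in>F. Y k \<omega>)} = {\<omega> \<in> space M. exp y \<le> exp (\<Sum>k\<in>F. Y k \<omega>)}"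
    by simp
  also have "prob \<dots> \<le> (\<integral>\<omega>. exp (\<Sum>k\<in>F. Y k \<omega>) \<partial>M) / exp y"
    by (rule integral_Markov_inequality_measure[OF I, of "{}", simplified]) auto
  also have "\<dots> \<le> exp (real (card F) * c) / exp y"
    using E by (intro divide_right_mono) auto
  finally show ?thesis by (simp add: exp_diff)
qed

section \<open>The probability of a misleading epoch\<close>

text \<open>Rebuilds a sample from the coordinates in A, with the default 0 elsewhere. A quantity
  that depends on A only is unchanged by this replacement and thereby becomes a function of the
  block.\<close>

definition table :: "('i + 'j) set \<Rightarrow> ('i + 'j \<Rightarrow> real) \<Rightarrow> ('i \<Rightarrow> real) \<times> ('j \<Rightarrow> real)" where
  "table A x = (\<lambda>i. if Inl i \<in> A then x (Inl i) else 0, \<lambda>j. if Inr j \<in> A then x (Inr j) else 0)"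

lemma coordinate_table: "coordinate k (table A x) = (if k \<in> A then x k else 0)"
  by (cases k) (auto simp: table_def)

context dp_rse
begin

abbreviation "\<Omega> \<equiv> sample_space K v u \<epsilon> \<beta> X"

lemma real_distribution_X: "a < K \<Longrightarrow> real_distribution (X a)"
  using heavy_tailed by (simp add: heavy_tailed_bandit_def)

lemma bounded_moment_X: "a < K \<Longrightarrow> bounded_moment (X a) v u"
  using heavy_tailed v_pos v_le
  by (auto simp: heavy_tailed_bandit_def bounded_moment_def bounded_moment_axioms_def)

sublocale tables: two_products reward_index noise_index "\<lambda>(t, a). X a" "\<lambda>(\<tau>, m, a). laplace (nscale \<tau> m)"
proof (rule two_products.intro)
  fix i assume "i \<in> reward_index"
  then have "real_distribution (X (snd i))"
    by (intro real_distribution_X) (auto simp: reward_index_def)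
  then show "prob_space (case i of (t, a) \<Rightarrow> X a)" "sets (case i of (t, a) \<Rightarrow> X a) = sets borel"
    by (auto simp: case_prod_beta real_distribution_def real_distribution_axioms_def)
qed (auto simp: noise_index_def intro!: prob_space_laplace nscale_pos)

lemma sample_space_eq: "\<Omega> = tables.PP"
  by (simp add: sample_space_def reward_index_def noise_index_def)

sublocale prob_space \<Omega>
  unfolding sample_space_eq by (rule tables.prob_space_PP)

abbreviation "indices \<equiv> reward_index <+> noise_index"

lemma indep_coordinates: "indep_vars (\<lambda>_. borel) coordinate indices"
  using tables.indep_coordinates by (simp add: sample_space_eq)

lemma measurable_sample_id: "measurable_sample \<Omega> (\<lambda>\<omega>. \<omega>)"
  using tables.measurable_coordinate by (simp add: measurable_sample_def sample_space_eq)

lemma measurable_sample_table: "measurable_sample (PiM A (\<lambda>_. borel)) (table A)"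
proof -
  have "(\<lambda>x. coordinate k (table A x)) \<in> borel_measurable (PiM A (\<lambda>_. borel))" for k
    by (cases "k \<in> A") (simp_all add: coordinate_table)
  then show ?thesis by (simp add: measurable_sample_def)
qed

lemma distr_reward:
  assumes "1 \<le> t" "a < K"
  shows "distr \<Omega> borel (\<lambda>\<omega>. fst \<omega> (t, a)) = X a"
  using tables.distr_coordinate[of "Inl (t, a)"] assms
  by (simp add: sample_space_eq coordinate_def[abs_def] reward_index_def Plus_def image_iff)

lemma distr_noise:
  assumes "1 \<le> \<tau>" "1 \<le> m" "m \<le> K" "a < K"
  shows "distr \<Omega> borel (\<lambda>\<omega>. snd \<omega> (\<tau>, m, a)) = laplace (nscale \<tau> m)"
  using tables.distr_coordinate[of "Inr (\<tau>, m, a)"] assms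
  by (simp add: sample_space_eq coordinate_def[abs_def] noise_index_def Plus_def image_iff)

text \<open>Reduces independence to a combinatorial check: F and G ignore the coordinates outside
  their blocks, hence factor through \<open>table\<close>.\<close>

lemma indep_of_blocks:
  assumes AB: "A \<inter> A' = {}" "A \<subseteq> indices" "A' \<subseteq> indices"
    and F: "\<And>\<omega> \<omega>'. (\<And>k. k \<in> A \<Longrightarrow> coordinate k \<omega> = coordinate k \<omega>') \<Longrightarrow> F \<omega> = F \<omega>'"
    and G: "\<And>\<omega> \<omega>'. (\<And>k. k \<in> A' \<Longrightarrow> coordinate k \<omega> = coordinate k \<omega>') \<Longrightarrow> G \<omega> = G \<omega>'"
    and "(\<lambda>x. F (table A x)) \<in> measurable (PiM A (\<lambda>_. borel)) N1"
    and "(\<lambda>x. G (table A' x)) \<in> measurable (PiM A' (\<lambda>_. borel)) N2"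
  shows "indep_var N1 F N2 G"
proof -
  have "F \<omega> = F (table A (\<lambda>k\<in>A. coordinate k \<omega>))" for \<omega>
    by (rule F) (simp add: coordinate_table)
  moreover have "G \<omega> = G (table A' (\<lambda>k\<in>A'. coordinate k \<omega>))" for \<omega>
    by (rule G) (simp add: coordinate_table)
  ultimately show ?thesis
    using indep_var_disjoint_blocks[OF indep_coordinates AB assms(6,7)] by simp
qed

definition rewards_upto :: "nat \<Rightarrow> ((nat \<times> nat) + (nat \<times> nat \<times> nat)) set" where
  "rewards_upto s = Inl ` {i \<in> reward_index. fst i \<le> s}"

definition noise_upto :: "nat \<Rightarrow> ((nat \<times> nat) + (nat \<times> nat \<times> nat)) set" where
  "noise_upto n = Inr ` {j \<in> noise_index. fst j \<le> n}"

lemma agree_on_block: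
  assumes "\<And>k. k \<in> rewards_upto s \<union> noise_upto n \<Longrightarrow> coordinate k \<omega> = coordinate k \<omega>'"
  shows "agree s n \<omega> \<omega>'"
  unfolding agree_def
proof (intro conjI ballI allI impI)
  fix t a assume "t \<in> {1..s}" "a < K"
  then show "fst \<omega> (t, a) = fst \<omega>' (t, a)"
    using assms[of "Inl (t, a)"] by (auto simp: rewards_upto_def reward_index_def)
next
  fix \<tau> m a assume "\<tau> \<in> {1..n}" "m \<in> {1..K}" "a < K"
  then show "snd \<omega> (\<tau>, m, a) = snd \<omega>' (\<tau>, m, a)"
    using assms[of "Inr (\<tau>, m, a)"] by (auto simp: noise_upto_def noise_index_def)
qed

subsection \<open>Concentration of the private means\<close>

text \<open>The 6 is half of the elimination threshold 12, since a comparison of two arms involves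
  two such errors.\<close>

definition far :: "sample \<Rightarrow> nat \<Rightarrow> nat set \<Rightarrow> nat \<Rightarrow> nat \<Rightarrow> bool" where
  "far \<omega> n S s a \<longleftrightarrow> 6 * err (Suc n) (card S) < \<bar>pmean \<omega> (Suc n) S s a - arm_mean X a\<bar>"

lemma pred_far:
  assumes "measurable_sample N h" "S \<in> viable_sets" "a \<in> S"
  shows "Measurable.pred N (\<lambda>x. far (h x) n S s a)"
proof -
  have [measurable]: "(\<lambda>x. pmean (h x) (Suc n) S s a) \<in> borel_measurable N"
    using assms by (intro measurable_private_mean) auto
  show ?thesis unfolding far_def by measurable
qed

text \<open>With S and s fixed, F is a fixed set of exactly R rounds. The values 1 and - 1 of
  \<sigma> give the upper and the lower deviation.\<close>

lemma prob_reward_average: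
  fixes n s :: nat and \<sigma> :: real
  assumes S: "S \<in> viable_sets" "a \<in> S" and \<sigma>: "\<bar>\<sigma>\<bar> = 1"
  defines "m \<equiv> card S" and "\<tau> \<equiv> Suc n"
  defines "F \<equiv> {t \<in> {s<..s + m * R \<tau> m}. cycle_arm S s t = a}"
  shows "prob {\<omega> \<in> space \<Omega>. 2 * err \<tau> m \<le> \<sigma> * ((\<Sum>t\<in>F. truncation (B \<tau> m) (fst \<omega> (t, a))) / R \<tau> m
            - (\<integral>x. truncation (B \<tau> m) x \<partial>X a))} \<le> exp (- L \<tau> m)"
    (is "prob ?E \<le> _")
proof -
  note S' = viable_setsD[OF S(1)]
  have \<tau>: "1 \<le> \<tau>" and m: "1 \<le> m" and a: "a < K"
    using S' S by (auto simp: \<tau>_def m_def)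
  note params = B_pos[OF \<tau> m] R_ge_1[OF \<tau> m] L_ge_1[OF \<tau> m]
  interpret Xa: bounded_moment "X a" v u by (rule bounded_moment_X[OF a])
  define b where "b = B \<tau> m"
  define \<mu> where "\<mu> = (\<integral>x. truncation b x \<partial>X a)"
  let ?k = "\<lambda>t. Inl (t, a) :: (nat \<times> nat) + (nat \<times> nat \<times> nat)"
  let ?Y = "\<lambda>k \<omega>. \<sigma> * truncation b (coordinate k \<omega>) / b"
  have b: "0 < b" using params by (simp add: b_def)
  have cardF: "card F = R \<tau> m"
    unfolding F_def m_def using S S' by (intro card_cycle_rounds) auto
  have F: "1 \<le> t" if "t \<in> F" for t
    using that by (auto simp: F_def)
  have sub: "?k ` F \<subseteq> indices"
    using F a by (auto simp: reward_index_def)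
  have ind: "indep_vars (\<lambda>_. borel) ?Y (?k ` F)"
    by (rule indep_vars_compose2[OF indep_vars_subset[OF indep_coordinates sub]]) measurable
  have dist: "distr \<Omega> borel (coordinate k) = X a" and cmeas: "random_variable borel (coordinate k)"
    if "k \<in> ?k ` F" for k
  proof -
    from that obtain t where t: "t \<in> F" "k = ?k t" by auto
    show "distr \<Omega> borel (coordinate k) = X a"
      using distr_reward[OF F[OF t(1)] a] by (simp add: t(2) coordinate_def[abs_def])
    show "random_variable borel (coordinate k)"
      using tables.measurable_coordinate[of k] sub that by (auto simp: sample_space_eq)
  qed
  \<comment> \<open>The event is rescaled by R / b, which turns the deviation 2 err into 2 L /
    \<epsilon>. By \<open>R_div_B\<close> the moment term uses up one L / \<epsilon>; the other one
    remains in the exponent and is at least L because \<epsilon> \<le> 1.\<close>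
  have "prob {\<omega> \<in> space \<Omega>. real (R \<tau> m) * (\<sigma> * \<mu> / b) + 2 * (L \<tau> m / \<epsilon>) \<le> (\<Sum>k\<in>?k ` F. ?Y k \<omega>)} \<le>
    exp (real (card (?k ` F)) * (\<sigma> * \<mu> / b + u * b powr (- 1 - v))
       - (real (R \<tau> m) * (\<sigma> * \<mu> / b) + 2 * (L \<tau> m / \<epsilon>)))"
  proof (rule chernoff_sum[OF _ ind])
    fix k assume k: "k \<in> ?k ` F"
    note [measurable] = cmeas[OF k]
    have "integrable (distr \<Omega> borel (coordinate k)) (\<lambda>x. exp (\<sigma> * truncation b x / b))"
      using Xa.truncation_exponential_moment(1)[OF b, of \<sigma>] \<sigma> by (simp add: dist[OF k])
    then show "integrable \<Omega> (\<lambda>\<omega>. exp (?Y k \<omega>))"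
      by (subst (asm) integrable_distr_eq) auto
    have "(\<integral>\<omega>. exp (?Y k \<omega>) \<partial>\<Omega>) = (\<integral>x. exp (\<sigma> * truncation b x / b) \<partial>distr \<Omega> borel (coordinate k))"
      by (subst integral_distr) auto
    then show "(\<integral>\<omega>. exp (?Y k \<omega>) \<partial>\<Omega>) \<le> exp (\<sigma> * \<mu> / b + u * b powr (- 1 - v))"
      using Xa.truncation_exponential_moment(2)[OF b, of \<sigma>] \<sigma> by (simp add: dist[OF k] \<mu>_def)
  qed (simp add: F_def)
  also have "real (card (?k ` F)) = R \<tau> m"
    by (subst card_image) (auto simp: inj_on_def cardF)
  also have "R \<tau> m * (\<sigma> * \<mu> / b + u * b powr (- 1 - v)) - (R \<tau> m * (\<sigma> * \<mu> / b) + 2 * (L \<tau> m / \<epsilon>)) = - (L \<tau> m / \<epsilon>)"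
    using R_div_B[OF \<tau> m] by (simp add: b_def algebra_simps)
  also have "exp (- (L \<tau> m / \<epsilon>)) \<le> exp (- L \<tau> m)"
    using params \<epsilon>_pos \<epsilon>_le by (simp add: le_divide_eq mult_left_le)
  also have "{\<omega> \<in> space \<Omega>. real (R \<tau> m) * (\<sigma> * \<mu> / b) + 2 * (L \<tau> m / \<epsilon>) \<le> (\<Sum>k\<in>?k ` F. ?Y k \<omega>)} = ?E"
  proof -
    have "R \<tau> m * (\<sigma> * \<mu> / b) + 2 * (L \<tau> m / \<epsilon>) \<le> (\<Sum>k\<in>?k ` F. ?Y k \<omega>) \<longleftrightarrow>
      2 * err \<tau> m \<le> \<sigma> * ((\<Sum>t\<in>F. truncation b (fst \<omega> (t, a))) / R \<tau> m - \<mu>)" (is "?l \<longleftrightarrow> _") for \<omega>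
    proof -
      define Z where "Z = (\<Sum>t\<in>F. truncation b (fst \<omega> (t, a)))"
      have Rb: "0 < R \<tau> m / b" using b params by simp
      have "(\<Sum>k\<in>?k ` F. ?Y k \<omega>) = (\<Sum>t\<in>F. \<sigma> * truncation b (fst \<omega> (t, a)) / b)"
        by (subst sum.reindex) (auto simp: inj_on_def)
      also have "\<dots> = \<sigma> * Z / b"
        by (simp add: Z_def sum_distrib_left sum_divide_distrib)
      also have "\<dots> = R \<tau> m / b * (\<sigma> * (Z / R \<tau> m))"
        using params by simp
      finally have 1: "(\<Sum>k\<in>?k ` F. ?Y k \<omega>) = R \<tau> m / b * (\<sigma> * (Z / R \<tau> m))" .
      have "R \<tau> m / b * err \<tau> m = L \<tau> m / \<epsilon>"
        using params \<epsilon>_pos b by (simp add: B_mult_L[OF \<tau> m, symmetric] b_def)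
      then have 2: "R \<tau> m * (\<sigma> * \<mu> / b) + 2 * (L \<tau> m / \<epsilon>) = R \<tau> m / b * (\<sigma> * \<mu> + 2 * err \<tau> m)"
        by (simp add: algebra_simps)
      show ?thesis
        unfolding 1 2 mult_le_cancel_left_pos[OF Rb] Z_def[symmetric] by (simp add: right_diff_distrib le_diff_eq add.commute)
    qed
    then show ?thesis by (simp add: b_def \<mu>_def)
  qed
  finally show ?thesis .
qed

lemma prob_noise:
  assumes S: "S \<in> viable_sets" "a \<in> S"
  shows "prob {\<omega> \<in> space \<Omega>. 2 * err (Suc n) (card S) \<le> \<bar>snd \<omega> (Suc n, card S, a)\<bar>} = exp (- L (Suc n) (card S))"
proof -
  note S' = viable_setsD[OF S(1)]
  let ?m = "card S" and ?\<tau> = "Suc n"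
  have [measurable]: "(\<lambda>\<omega>. snd \<omega> (?\<tau>, ?m, a)) \<in> borel_measurable \<Omega>"
    using S S' by (intro measurable_noise[OF measurable_sample_id]) auto
  have "emeasure \<Omega> {\<omega> \<in> space \<Omega>. 2 * err ?\<tau> ?m \<le> \<bar>snd \<omega> (?\<tau>, ?m, a)\<bar>} =
      emeasure (distr \<Omega> borel (\<lambda>\<omega>. snd \<omega> (?\<tau>, ?m, a))) {z. 2 * err ?\<tau> ?m \<le> \<bar>z\<bar>}"
    by (subst emeasure_distr) (auto intro!: arg_cong2[where f=emeasure])
  also have "\<dots> = ennreal (exp (- (2 * err ?\<tau> ?m) / nscale ?\<tau> ?m))"
    using S S' err_pos[of ?\<tau> ?m] nscale_pos[of ?\<tau> ?m] by (subst distr_noise) (auto simp: laplace_tail)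
  also have "- (2 * err ?\<tau> ?m) / nscale ?\<tau> ?m = - L ?\<tau> ?m"
    using S' nscale_mult_L[of ?\<tau> ?m] nscale_pos[of ?\<tau> ?m] by (simp add: field_simps)
  finally show ?thesis
    by (simp add: emeasure_eq_measure)
qed

lemma prob_far:
  assumes S: "S \<in> viable_sets" "a \<in> S"
  shows "prob {\<omega> \<in> space \<Omega>. far \<omega> n S s a} \<le> 3 * exp (- L (Suc n) (card S))"
proof -
  note S' = viable_setsD[OF S(1)]
  let ?m = "card S" and ?\<tau> = "Suc n"
  let ?b = "B ?\<tau> ?m" and ?e = "err ?\<tau> ?m"
  define F where "F = {t \<in> {s<..s + ?m * R ?\<tau> ?m}. cycle_arm S s t = a}"
  define avg where "avg \<omega> = (\<Sum>t\<in>F. truncation ?b (fst \<omega> (t, a))) / R ?\<tau> ?m" for \<omega> :: sample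
  define \<mu> where "\<mu> = (\<integral>x. truncation ?b x \<partial>X a)"
  define E where "E \<sigma> = {\<omega> \<in> space \<Omega>. 2 * ?e \<le> \<sigma> * (avg \<omega> - \<mu>)}" for \<sigma> :: real
  define N where "N = {\<omega> \<in> space \<Omega>. 2 * ?e \<le> \<bar>snd \<omega> (?\<tau>, ?m, a)\<bar>}"
  have m: "1 \<le> ?\<tau>" "1 \<le> ?m" and a: "a < K" using S S' by auto
  interpret Xa: bounded_moment "X a" v u by (rule bounded_moment_X[OF a])
  have bias: "\<bar>\<mu> - arm_mean X a\<bar> \<le> ?e"
    using Xa.truncation_bias[OF B_pos[OF m]] u_div_B[OF m] by (simp add: arm_mean_def \<mu>_def)
  have pm: "pmean \<omega> ?\<tau> S s a = avg \<omega> + snd \<omega> (?\<tau>, ?m, a)" for \<omega>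
    by (simp add: private_mean_def Let_def avg_def F_def truncation_def)
  have [measurable]: "(\<lambda>\<omega>. fst \<omega> (t, a)) \<in> borel_measurable \<Omega>" if "t \<in> F" for t
    using that a by (intro measurable_reward[OF measurable_sample_id]) (auto simp: F_def)
  have [measurable]: "(\<lambda>\<omega>. snd \<omega> (?\<tau>, ?m, a)) \<in> borel_measurable \<Omega>"
    using a S' by (intro measurable_noise[OF measurable_sample_id]) auto
  have [measurable]: "avg \<in> borel_measurable \<Omega>"
    unfolding avg_def[abs_def] by measurable
  have ev: "E 1 \<in> events" "E (- 1) \<in> events" "N \<in> events"
    unfolding E_def N_def by measurable
  \<comment> \<open>Outside the three events the error is at most 1 + 2 + 2 = 5 times err: bias,
    average and noise.\<close>
  have "{\<omega> \<in> space \<Omega>. far \<omega> n S s a} \<subseteq> (E 1 \<union> E (- 1)) \<union> N"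
    using bias err_pos[OF m] by (auto simp: far_def pm E_def N_def)
  then have "prob {\<omega> \<in> space \<Omega>. far \<omega> n S s a} \<le> prob ((E 1 \<union> E (- 1)) \<union> N)"
    using ev by (intro finite_measure_mono) auto
  also have "\<dots> \<le> prob (E 1) + prob (E (- 1)) + prob N"
    using ev measure_Un_le[of "E 1 \<union> E (- 1)" \<Omega> N] measure_Un_le[of "E 1" \<Omega> "E (- 1)"] by auto
  also have "\<dots> \<le> exp (- L ?\<tau> ?m) + exp (- L ?\<tau> ?m) + exp (- L ?\<tau> ?m)"
    using prob_reward_average[OF S, of 1 n s] prob_reward_average[OF S, of "-1" n s] prob_noise[OF S, of n]
    by (intro add_mono) (auto simp: E_def N_def avg_def F_def \<mu>_def)
  finally show ?thesis by simp
qed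

text \<open>The argument of the logarithm in L is designed for this union bound: 3 exp (- L) for
  each of the \<open>card S\<close> arms costs 3/4 of the claimed bound. The result is the same for
  all S and s, which allows it to be applied in a random state.\<close>

lemma prob_some_far:
  assumes "S \<in> viable_sets"
  shows "prob {\<omega> \<in> space \<Omega>. \<exists>a\<in>S. far \<omega> n S s a} \<le> \<beta> / (real (Suc n))\<^sup>2"
proof -
  note S = viable_setsD[OF assms]
  let ?m = "card S"
  have [measurable]: "{\<omega> \<in> space \<Omega>. far \<omega> n S s a} \<in> events" if "a \<in> S" for a
    using pred_far[OF measurable_sample_id assms that] by (simp add: pred_def)
  have "prob {\<omega> \<in> space \<Omega>. \<exists>a\<in>S. far \<omega> n S s a} = prob (\<Union>a\<in>S. {\<omega> \<in> space \<Omega>. far \<omega> n S s a})"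
    by (rule arg_cong[where f=prob]) auto
  also have "\<dots> \<le> (\<Sum>a\<in>S. prob {\<omega> \<in> space \<Omega>. far \<omega> n S s a})"
    using S by (intro finite_measure_subadditive_finite) auto
  also have "\<dots> \<le> (\<Sum>a\<in>S. 3 * exp (- L (Suc n) ?m))"
    by (intro sum_mono prob_far assms)
  also have "\<dots> = 3 * ?m * exp (- L (Suc n) ?m)"
    by simp
  also have "exp (- L (Suc n) ?m) = \<beta> / (4 * real ?m * (real (Suc n))\<^sup>2)"
    using S \<beta>_pos by (simp add: epoch_L_def exp_minus)
  also have "3 * ?m * (\<beta> / (4 * real ?m * (real (Suc n))\<^sup>2)) = 3 / 4 * (\<beta> / (real (Suc n))\<^sup>2)"
    using S by simp
  also have "\<dots> \<le> \<beta> / (real (Suc n))\<^sup>2"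
    using \<beta>_pos by (intro mult_left_le_one_le) auto
  finally show ?thesis .
qed

text \<open>Here s is a fixed number, so the event on the state lives on the block \<open>?A\<close>
  of past rewards and noises, and the event on the epoch on its complement. Hence the probability
  factorises.\<close>

lemma prob_state_and_far:
  assumes S: "S \<in> viable_sets"
  shows "prob {\<omega> \<in> space \<Omega>. state \<omega> n = (S, s) \<and> (\<exists>a\<in>S. far \<omega> n S s a)} \<le>
    \<beta> / (real (Suc n))\<^sup>2 * prob {\<omega> \<in> space \<Omega>. state \<omega> n = (S, s)}"
proof -
  let ?A = "rewards_upto s \<union> noise_upto n"
  let ?F = "\<lambda>\<omega>. state \<omega> n = (S, s)" and ?G = "\<lambda>\<omega>. \<exists>a\<in>S. far \<omega> n S s a"
  note S' = viable_setsD[OF S]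
  have "indep_var (count_space UNIV) ?F (count_space UNIV) ?G"
  proof (rule indep_of_blocks[of ?A "indices - ?A"])
    show "?A \<subseteq> indices" by (auto simp: rewards_upto_def noise_upto_def)
    fix \<omega> \<omega>' :: sample
    assume "\<And>k. k \<in> ?A \<Longrightarrow> coordinate k \<omega> = coordinate k \<omega>'"
    then have ag: "agree s n \<omega> \<omega>'" by (rule agree_on_block)
    show "?F \<omega> = ?F \<omega>'"
      \<comment> \<open>Whichever of the two runs is in state (S, s), agreement up to s suffices to
        transfer this to the other one, so both directions are needed.\<close>
      using state_cong[of \<omega> n \<omega>'] state_cong[of \<omega>' n \<omega>] ag agree_sym[OF ag] by auto
  next
    fix \<omega> \<omega>' :: sample
    assume eq: "\<And>k. k \<in> indices - ?A \<Longrightarrow> coordinate k \<omega> = coordinate k \<omega>'"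
    have "pmean \<omega> (Suc n) S s a = pmean \<omega>' (Suc n) S s a" if "a \<in> S" for a
    proof (rule private_mean_cong[OF S that])
      fix t assume "t \<in> {s<..s + card S * R (Suc n) (card S)}"
      then show "fst \<omega> (t, a) = fst \<omega>' (t, a)"
        using eq[of "Inl (t, a)"] that S' by (auto simp: reward_index_def rewards_upto_def noise_upto_def Plus_def image_iff)
    next
      show "snd \<omega> (Suc n, card S, a) = snd \<omega>' (Suc n, card S, a)"
        using eq[of "Inr (Suc n, card S, a)"] that S' by (auto simp: noise_index_def rewards_upto_def noise_upto_def Plus_def image_iff)
    qed
    then show "?G \<omega> = ?G \<omega>'" by (simp add: far_def)
  next
    show "(\<lambda>x. ?F (table ?A x)) \<in> measurable (PiM ?A (\<lambda>_. borel)) (count_space UNIV)"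
      by (rule measurable_function_of_state[OF measurable_sample_table, of "\<lambda>p. p = (S, s)"])
    show "(\<lambda>x. ?G (table (indices - ?A) x)) \<in> measurable (PiM (indices - ?A) (\<lambda>_. borel)) (count_space UNIV)"
      using S' by (intro pred_intros_finite pred_far[OF measurable_sample_table S]) auto
  qed auto
  from indep_varD[OF this, of "{True}" "{True}"]
  have "prob {\<omega> \<in> space \<Omega>. ?F \<omega> \<and> ?G \<omega>} = prob {\<omega> \<in> space \<Omega>. ?F \<omega>} * prob {\<omega> \<in> space \<Omega>. ?G \<omega>}"
    by (simp add: vimage_def Int_def conj_commute conj_left_commute)
  also have "\<dots> \<le> prob {\<omega> \<in> space \<Omega>. ?F \<omega>} * (\<beta> / (real (Suc n))\<^sup>2)"
    by (intro mult_left_mono prob_some_far S) simp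
  finally show ?thesis by (simp add: mult.commute)
qed

section \<open>Union over states and epochs\<close>

definition bad :: "sample \<Rightarrow> nat \<Rightarrow> bool" where
  "bad \<omega> n \<longleftrightarrow> (\<exists>a\<in>fst (state \<omega> n). far \<omega> n (fst (state \<omega> n)) (snd (state \<omega> n)) a)"

lemma countable_states: "countable (viable_sets \<times> (UNIV :: nat set))"
  by (intro countable_SIGMA) (auto simp: viable_sets_def intro: countable_finite)

text \<open>The states split the sample space into countably many disjoint events. On each of them
  the same factor bounds the failure, and the probabilities of the states sum to at most 1.\<close>

lemma
  shows events_bad: "{\<omega> \<in> space \<Omega>. bad \<omega> n} \<in> events"
    and prob_bad_epoch: "prob {\<omega> \<in> space \<Omega>. bad \<omega> n} \<le> \<beta> / (real (Suc n))\<^sup>2"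
proof -
  let ?I = "viable_sets \<times> (UNIV :: nat set)"
  let ?c = "\<beta> / (real (Suc n))\<^sup>2"
  let ?E = "\<lambda>p. {\<omega> \<in> space \<Omega>. state \<omega> n = p}"
  let ?D = "\<lambda>p. {\<omega> \<in> space \<Omega>. state \<omega> n = p \<and> (\<exists>a\<in>fst p. far \<omega> n (fst p) (snd p) a)}"
  have in_I: "state \<omega> n \<in> ?I" for \<omega>
    using state_viable[of \<omega> n] by (cases "state \<omega> n") auto
  have E: "?E p \<in> events" for p
    using measurable_function_of_state[OF measurable_sample_id, of "\<lambda>q. q = p" n] by (simp add: pred_def)
  have D: "?D p \<in> events" if "p \<in> ?I" for p
  proof -
    have "Measurable.pred \<Omega> (\<lambda>\<omega>. state \<omega> n = p \<and> (\<exists>a\<in>fst p. far \<omega> n (fst p) (snd p) a))"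
      using that viable_setsD[of "fst p"] measurable_function_of_state[OF measurable_sample_id, of "\<lambda>q. q = p" n]
      by (intro pred_intros_logic pred_intros_finite pred_far[OF measurable_sample_id]) auto
    then show ?thesis by (simp add: pred_def)
  qed
  have bad: "{\<omega> \<in> space \<Omega>. bad \<omega> n} = (\<Union>p\<in>?I. ?D p)"
    using in_I by (force simp: bad_def)
  show "{\<omega> \<in> space \<Omega>. bad \<omega> n} \<in> events"
    unfolding bad using D countable_states by (intro sets.countable_UN'') auto
  have "emeasure \<Omega> {\<omega> \<in> space \<Omega>. bad \<omega> n} = (\<integral>\<^sup>+p. emeasure \<Omega> (?D p) \<partial>count_space ?I)"
    unfolding bad using D countable_states by (intro emeasure_UN_countable) (auto simp: disjoint_family_on_def)
  also have "\<dots> \<le> (\<integral>\<^sup>+p. ennreal ?c * emeasure \<Omega> (?E p) \<partial>count_space ?I)"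
  proof (rule nn_integral_mono)
    fix p assume "p \<in> space (count_space ?I)"
    then have "prob (?D p) \<le> ?c * prob (?E p)"
      using prob_state_and_far[of "fst p" n "snd p"] by auto
    then have "ennreal (prob (?D p)) \<le> ennreal (?c * prob (?E p))"
      by (rule ennreal_leI)
    then show "emeasure \<Omega> (?D p) \<le> ennreal ?c * emeasure \<Omega> (?E p)"
      using \<beta>_pos by (subst (asm) ennreal_mult) (auto simp: emeasure_eq_measure)
  qed
  also have "\<dots> = ennreal ?c * (\<integral>\<^sup>+p. emeasure \<Omega> (?E p) \<partial>count_space ?I)"
    by (rule nn_integral_cmult) simp
  also have "(\<integral>\<^sup>+p. emeasure \<Omega> (?E p) \<partial>count_space ?I) = emeasure \<Omega> (\<Union>p\<in>?I. ?E p)"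
    using E countable_states by (intro emeasure_UN_countable[symmetric]) (auto simp: disjoint_family_on_def)
  also have "\<dots> \<le> 1"
    by (simp add: emeasure_le_1)
  finally have "emeasure \<Omega> {\<omega> \<in> space \<Omega>. bad \<omega> n} \<le> ennreal ?c"
    by (simp add: mult_left_mono)
  then show "prob {\<omega> \<in> space \<Omega>. bad \<omega> n} \<le> ?c"
    using \<beta>_pos by (simp add: emeasure_eq_measure)
qed

lemma events_ever_bad: "{\<omega> \<in> space \<Omega>. \<exists>n. bad \<omega> n} \<in> events"
proof -
  have "{\<omega> \<in> space \<Omega>. \<exists>n. bad \<omega> n} = (\<Union>n. {\<omega> \<in> space \<Omega>. bad \<omega> n})" by auto
  then show ?thesis using events_bad by auto
qed

lemma prob_ever_bad: "prob {\<omega> \<in> space \<Omega>. \<exists>n. bad \<omega> n} \<le> 3 * \<beta>"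
proof -
  let ?c = "\<lambda>n. \<beta> * (1 / (real n + 1)\<^sup>2)"
  have sums: "?c sums (\<beta> * (pi\<^sup>2 / 6))"
    using inverse_squares_sums by (intro sums_mult) (simp add: add.commute)
  have le: "prob {\<omega> \<in> space \<Omega>. bad \<omega> n} \<le> ?c n" for n
    using prob_bad_epoch[of n] by (simp add: add.commute)
  have summ: "summable (\<lambda>n. prob {\<omega> \<in> space \<Omega>. bad \<omega> n})"
    using le by (intro summable_comparison_test'[OF sums_summable[OF sums]]) auto
  have "{\<omega> \<in> space \<Omega>. \<exists>n. bad \<omega> n} = (\<Union>n. {\<omega> \<in> space \<Omega>. bad \<omega> n})" by auto
  then have "prob {\<omega> \<in> space \<Omega>. \<exists>n. bad \<omega> n} \<le> (\<Sum>n. prob {\<omega> \<in> space \<Omega>. bad \<omega> n})"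
    using finite_measure_subadditive_countably[of "\<lambda>n. {\<omega> \<in> space \<Omega>. bad \<omega> n}"] events_bad summ by auto
  also have "\<dots> \<le> \<beta> * (pi\<^sup>2 / 6)"
    using suminf_le[OF le summ sums_summable[OF sums]] sums_unique[OF sums] by simp
  also have "\<dots> \<le> \<beta> * 3"
  proof -
    \<comment> \<open>The crude bound pi < 4 is enough: 16 / 6 < 3.\<close>
    have "pi\<^sup>2 \<le> 4\<^sup>2" using pi_less_4 pi_gt_zero by (intro power_mono) auto
    then show ?thesis using \<beta>_pos by (intro mult_left_mono) auto
  qed
  finally show ?thesis by (simp add: mult.commute)
qed

subsection \<open>The regret as an expected sum of gaps\<close>

lemma measurable_pulled [measurable]: "(\<lambda>\<omega>. pulled \<omega> t) \<in> measurable \<Omega> (count_space UNIV)"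
  by (rule measurable_pulled_arm[OF measurable_sample_id])

text \<open>Whether arm a is pulled in round t depends only on earlier rewards and on noises, hence
  is independent of the reward of a in round t. Summing the products over the arms replaces the
  observed reward by the mean of the pulled arm.\<close>

lemma
  assumes "1 \<le> t"
  shows integrable_observed: "integrable \<Omega> (\<lambda>\<omega>. observed_reward K v u \<epsilon> \<beta> \<omega> t)"
    and expectation_observed: "expectation (\<lambda>\<omega>. observed_reward K v u \<epsilon> \<beta> \<omega> t) =
      expectation (\<lambda>\<omega>. arm_mean X (pulled \<omega> t))"
proof -
  let ?F = "\<lambda>a \<omega>. indicator {a} (pulled \<omega> t) :: real" and ?G = "\<lambda>a \<omega>. fst \<omega> (t, a)"
  have ind: "indep_var borel (?F a) borel (?G a)" if a: "a < K" for a
  proof (rule indep_of_blocks[of "rewards_upto (t - 1) \<union> Inr ` noise_index" "{Inl (t, a)}"])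
    show "(rewards_upto (t - 1) \<union> Inr ` noise_index) \<inter> {Inl (t, a)} = {}"
      using assms by (auto simp: rewards_upto_def)
    show "rewards_upto (t - 1) \<union> Inr ` noise_index \<subseteq> indices"
      by (auto simp: rewards_upto_def)
    show "{Inl (t, a)} \<subseteq> indices"
      using a assms by (auto simp: reward_index_def)
    fix \<omega> \<omega>' :: sample
    assume eq: "\<And>k. k \<in> rewards_upto (t - 1) \<union> Inr ` noise_index \<Longrightarrow> coordinate k \<omega> = coordinate k \<omega>'"
    have "agree (t - 1) n \<omega> \<omega>'" for n
      by (rule agree_on_block) (auto intro!: eq simp: noise_upto_def)
    then show "?F a \<omega> = ?F a \<omega>'"
      using pulled_arm_cong[OF assms, of \<omega> \<omega>'] by simp
  next
    fix \<omega> \<omega>' :: sample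
    assume "\<And>k. k \<in> {Inl (t, a)} \<Longrightarrow> coordinate k \<omega> = coordinate k \<omega>'"
    then show "?G a \<omega> = ?G a \<omega>'" by fastforce
  next
    show "(\<lambda>x. ?F a (table A x)) \<in> borel_measurable (PiM A (\<lambda>_. borel))" for A
      by (rule measurable_compose[OF measurable_pulled_arm[OF measurable_sample_table]]) simp
    show "(\<lambda>x. ?G a (table A x)) \<in> borel_measurable (PiM A (\<lambda>_. borel))"
      for A :: "((nat \<times> nat) + (nat \<times> nat \<times> nat)) set"
      by (rule measurable_reward[OF measurable_sample_table assms a])
  qed
  have F: "integrable \<Omega> (?F a)" for a
    by (rule integrable_const_bound[of _ 1]) (auto intro: measurable_compose[OF measurable_pulled])
  have G: "integrable \<Omega> (?G a)" "expectation (?G a) = arm_mean X a" if a: "a < K" for a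
  proof -
    interpret Xa: bounded_moment "X a" v u by (rule bounded_moment_X[OF a])
    have [measurable]: "?G a \<in> borel_measurable \<Omega>"
      by (rule measurable_reward[OF measurable_sample_id assms a])
    have "integrable (distr \<Omega> borel (?G a)) (\<lambda>x. x)"
      using Xa.integrable_id unfolding distr_reward[OF assms a] .
    then show "integrable \<Omega> (?G a)"
      by (simp add: integrable_distr_eq)
    have "expectation (?G a) = (\<integral>x. x \<partial>distr \<Omega> borel (?G a))"
      by (subst integral_distr) auto
    then show "expectation (?G a) = arm_mean X a"
      by (simp only: arm_mean_def distr_reward[OF assms a])
  qed
  have split: "observed_reward K v u \<epsilon> \<beta> \<omega> t = (\<Sum>a<K. ?F a \<omega> * ?G a \<omega>)" for \<omega>
    using pulled_arm_less[of \<omega> t] by (simp add: observed_reward_def indicator_def sum.delta if_distrib cong: if_cong)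
  have split': "arm_mean X (pulled \<omega> t) = (\<Sum>a<K. ?F a \<omega> * arm_mean X a)" for \<omega>
    using pulled_arm_less[of \<omega> t] by (simp add: indicator_def sum.delta if_distrib cong: if_cong)
  show "integrable \<Omega> (\<lambda>\<omega>. observed_reward K v u \<epsilon> \<beta> \<omega> t)"
    unfolding split by (intro Bochner_Integration.integrable_sum indep_var_integrable[OF ind F] G) auto
  have "expectation (\<lambda>\<omega>. observed_reward K v u \<epsilon> \<beta> \<omega> t) = (\<Sum>a<K. expectation (?F a) * arm_mean X a)"
    unfolding split
    by (subst Bochner_Integration.integral_sum)
       (auto intro!: sum.cong indep_var_integrable[OF ind F] G simp: indep_var_lebesgue_integral[OF ind F G(1)] G(2))
  also have "\<dots> = expectation (\<lambda>\<omega>. arm_mean X (pulled \<omega> t))"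
    unfolding split' using F by (subst Bochner_Integration.integral_sum) auto
  finally show "expectation (\<lambda>\<omega>. observed_reward K v u \<epsilon> \<beta> \<omega> t) = expectation (\<lambda>\<omega>. arm_mean X (pulled \<omega> t))" .
qed

lemma integrable_gap: "integrable \<Omega> (\<lambda>\<omega>. gap K X (pulled \<omega> t))"
proof (rule integrable_const_bound)
  show "AE \<omega> in \<Omega>. norm (gap K X (pulled \<omega> t)) \<le> (\<Sum>a<K. \<bar>gap K X a\<bar>)"
    using pulled_arm_less member_le_sum[of _ "{..<K}" "\<lambda>a. \<bar>gap K X a\<bar>"] by (intro AE_I2) auto
  show "(\<lambda>\<omega>. gap K X (pulled \<omega> t)) \<in> borel_measurable \<Omega>"
    by (rule measurable_compose[OF measurable_pulled]) simp
qed

lemma expected_regret_eq: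
  "expected_regret K v u \<epsilon> \<beta> X T = expectation (\<lambda>\<omega>. \<Sum>t=1..T. gap K X (pulled \<omega> t))"
proof -
  have "expectation (\<lambda>\<omega>. \<Sum>t=1..T. observed_reward K v u \<epsilon> \<beta> \<omega> t) =
      (\<Sum>t=1..T. expectation (\<lambda>\<omega>. observed_reward K v u \<epsilon> \<beta> \<omega> t))"
    by (intro Bochner_Integration.integral_sum integrable_observed) auto
  also have "\<dots> = (\<Sum>t=1..T. best_mean K X - expectation (\<lambda>\<omega>. gap K X (pulled \<omega> t)))"
  proof (rule sum.cong)
    fix t assume "t \<in> {1..T}"
    then have "expectation (\<lambda>\<omega>. observed_reward K v u \<epsilon> \<beta> \<omega> t) =
        expectation (\<lambda>\<omega>. best_mean K X - gap K X (pulled \<omega> t))"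
      by (subst expectation_observed) (auto simp: gap_def)
    then show "expectation (\<lambda>\<omega>. observed_reward K v u \<epsilon> \<beta> \<omega> t) =
        best_mean K X - expectation (\<lambda>\<omega>. gap K X (pulled \<omega> t))"
      using integrable_gap by (simp add: prob_space)
  qed simp
  also have "\<dots> = T * best_mean K X - expectation (\<lambda>\<omega>. \<Sum>t=1..T. gap K X (pulled \<omega> t))"
    using integrable_gap by (simp add: sum_subtractf)
  finally show ?thesis by (simp add: expected_regret_def)
qed

end

section \<open>The regret bounds\<close>

text \<open>Here 10 = 2 * 5, with 2 from the geometric sum of epoch lengths and 5 from the bound on
  L. The bracket comes from R including its rounding, the power of 2 from one further epoch, and the
  power of 2 (1 + u) from the largest possible gap.\<close>

definition regret_const :: "real \<Rightarrow> real \<Rightarrow> real" where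
  "regret_const v u = 10 * (u powr (1 / v) * 24 powr ((1 + v) / v) + 2) * 2 powr ((1 + v) / v)
     * (2 * (1 + u)) powr ((1 + v) / v)"

lemma regret_const_pos: "0 < u \<Longrightarrow> 0 < regret_const v u"
  unfolding regret_const_def by (intro mult_pos_pos add_nonneg_pos) auto

lemma sum_powers_le:
  fixes r :: real
  assumes "2 \<le> r"
  shows "(\<Sum>n\<le>N. r ^ Suc n) \<le> 2 * r ^ Suc N"
proof (induction N)
  case (Suc N)
  have "2 * r ^ Suc N \<le> r * r ^ Suc N"
    using assms by (intro mult_right_mono) auto
  with Suc show ?case by simp
qed (use assms in simp)

lemma loglog_gap_nonneg: "0 \<le> loglog_gap d"
proof -
  have "ln (exp 1) \<le> ln (max (exp 1) (1 / d))"
    by (subst ln_le_cancel_iff) (auto simp: less_max_iff_disj)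
  then show ?thesis by (simp add: loglog_gap_def)
qed

text \<open>Since ln 2 \<ge> 1/2, n is at most 2 y for the inner logarithm y; as y \<ge> 1, also n +
  1 \<le> 3 y, which explains ln 3.\<close>

lemma ln_epochs_le:
  assumes "0 < d" "n = 0 \<or> d \<le> 1 / 2 ^ n"
  shows "ln (real (Suc n)) \<le> ln 3 + loglog_gap d"
proof -
  define y where "y = ln (max (exp 1) (1 / d))"
  have "ln (exp 1) \<le> y"
    unfolding y_def by (subst ln_le_cancel_iff) (auto simp: less_max_iff_disj)
  then have y: "1 \<le> y" by simp
  have "real n \<le> 2 * y"
  proof (cases "n = 0")
    case False
    with assms have "2 ^ n \<le> 1 / d" by (simp add: field_simps)
    then have "ln (2 ^ n) \<le> y"
      unfolding y_def by (subst ln_le_cancel_iff) (auto simp: less_max_iff_disj le_max_iff_disj)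
    then have "real n * ln 2 \<le> y" by (simp add: ln_realpow)
    moreover have "real n * (1 / 2) \<le> real n * ln 2"
      using ln2_ge_two_thirds by (intro mult_left_mono) auto
    ultimately show ?thesis by simp
  qed (use y in simp)
  then have "ln (real (Suc n)) \<le> ln (3 * y)"
    using y by (subst ln_le_cancel_iff) auto
  also have "\<dots> = ln 3 + loglog_gap d"
    using y by (simp add: ln_mult loglog_gap_def y_def)
  finally show ?thesis .
qed

text \<open>The alternative n = 0 reflects that nothing is known about the gap before the first
  elimination. There are finitely many candidates because n \<le> 2 ^ n \<le> 1 / d for the
  others.\<close>

lemma obtain_last_epoch:
  fixes d :: real
  assumes "0 < d"
  obtains N where "N = 0 \<or> d \<le> 1 / 2 ^ N" "\<forall>n. n = 0 \<or> d \<le> 1 / 2 ^ n \<longrightarrow> n \<le> N"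
proof -
  define E where "E = {n::nat. n = 0 \<or> d \<le> 1 / 2 ^ n}"
  have "E \<subseteq> {..nat \<lceil>1 / d\<rceil>}"
  proof
    fix n assume "n \<in> E"
    then consider "n = 0" | "2 ^ n \<le> 1 / d"
      using assms by (auto simp: E_def field_simps)
    then show "n \<in> {..nat \<lceil>1 / d\<rceil>}"
    proof cases
      case 2
      have "real n \<le> 2 ^ n" by (simp add: less_imp_le)
      from this 2 have "real n \<le> 1 / d" by (rule order_trans)
      then show ?thesis by simp linarith
    qed simp
  qed
  then have fin: "finite E" by (rule finite_subset) simp
  have "0 \<in> E" by (simp add: E_def)
  then have "Max E \<in> E" using fin by (intro Max_in) auto
  with fin show thesis
    by (intro that[of "Max E"]) (auto simp: E_def)
qed

context dp_rse
begin

lemma gap_nonneg: "a < K \<Longrightarrow> 0 \<le> gap K X a"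
  unfolding gap_def best_mean_def by simp

lemma obtain_best_arm: obtains b where "b < K" "gap K X b = 0"
proof -
  have "Max (arm_mean X ` {..<K}) \<in> arm_mean X ` {..<K}"
    using K_pos by (intro Max_in) auto
  then show thesis using that by (auto simp: gap_def best_mean_def)
qed

text \<open>Needed for large gaps: such an arm is still pulled throughout the first epoch, and its
  cost must be charged to a power of 1 / gap, which is small.\<close>

lemma gap_le:
  assumes "a < K"
  shows "gap K X a \<le> 2 * (1 + u)"
proof -
  obtain b where b: "b < K" "gap K X b = 0" by (rule obtain_best_arm)
  interpret A: bounded_moment "X a" v u using assms by (rule bounded_moment_X)
  interpret Bb: bounded_moment "X b" v u using b(1) by (rule bounded_moment_X)
  have "- arm_mean X a \<le> 1 + u" "arm_mean X b \<le> 1 + u"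
    using A.abs_mean_le Bb.abs_mean_le by (simp_all add: arm_mean_def abs_le_iff)
  then show ?thesis
    using b(2) by (simp add: gap_def)
qed

lemma not_badD:
  assumes "\<not> bad \<omega> n" "a \<in> fst (state \<omega> n)"
  shows "\<bar>pmean \<omega> (Suc n) (fst (state \<omega> n)) (snd (state \<omega> n)) a - arm_mean X a\<bar>
    \<le> 6 * err (Suc n) (card (fst (state \<omega> n)))"
  using assms by (force simp: bad_def far_def)

lemma good_state:
  assumes good: "\<And>n. \<not> bad \<omega> n" and b: "b < K" "gap K X b = 0"
  shows "b \<in> fst (state \<omega> n) \<and> (\<forall>a\<in>fst (state \<omega> n). n = 0 \<or> gap K X a \<le> 1 / 2 ^ n)"
proof (induction n)
  case (Suc n)
  define S s where "S = fst (state \<omega> n)" and "s = snd (state \<omega> n)"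
  have bS: "b \<in> S" using Suc by (simp add: S_def)
  have "S \<in> viable_sets" by (simp add: S_def state_viable)
  note S = viable_setsD[OF this]
  show ?case
  proof (cases "card S = 1")
    case True
    \<comment> \<open>A single viable arm is the best arm, and the state is frozen.\<close>
    then have "S = {b}" using bS by (metis card_1_singletonE singletonD)
    then show ?thesis
      using True b unfolding S_def by (simp add: case_prod_beta Let_def)
  next
    case False
    define e where "e = err (Suc n) (card S)"
    let ?p = "pmean \<omega> (Suc n) S s"
    have close: "\<bar>?p a - arm_mean X a\<bar> \<le> 6 * e" if "a \<in> S" for a
      using not_badD[OF good, of a n] that by (simp add: S_def s_def e_def)
    have e: "24 * e \<le> 1 / 2 ^ Suc n"
      unfolding e_def using S by (intro err_le_epoch_D) auto
    have fst: "fst (state \<omega> (Suc n)) = elim \<omega> (Suc n) S s"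
      using False by (simp add: case_prod_beta Let_def S_def s_def)
    have "Max (?p ` S) \<in> ?p ` S" using S by (intro Max_in) auto
    then obtain a' where a': "a' \<in> S" "Max (?p ` S) = ?p a'" by auto
    \<comment> \<open>Two errors of at most 6 e, while the true mean of b is the larger one.\<close>
    have "Max (?p ` S) - ?p b \<le> 12 * e"
      using close[OF a'(1)] close[OF bS] gap_nonneg[OF S(5)[OF a'(1)]] b(2) unfolding a'(2) gap_def by linarith
    then have 1: "b \<in> elim \<omega> (Suc n) S s"
      using bS by (simp add: eliminate_def e_def)
    \<comment> \<open>The threshold 12 e plus two errors of 6 e gives 24 e.\<close>
    have 2: "gap K X a \<le> 1 / 2 ^ Suc n" if a: "a \<in> elim \<omega> (Suc n) S s" for a
    proof -
      have "a \<in> S" "Max (?p ` S) - ?p a \<le> 12 * e"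
        using a by (auto simp: eliminate_def e_def)
      moreover have "?p b \<le> Max (?p ` S)"
        using S bS by simp
      ultimately show ?thesis
        using close[OF bS] close[of a] e b(2) unfolding gap_def by linarith
    qed
    show ?thesis unfolding fst using 1 2 by simp
  qed
qed (use b in simp)

section \<open>Counting the pulls of an arm\<close>

definition pulls :: "sample \<Rightarrow> nat \<Rightarrow> nat \<Rightarrow> nat" where
  "pulls \<omega> T a = card {t \<in> {1..T}. pulled \<omega> t = a}"

lemma sum_over_rounds:
  fixes f :: "nat \<Rightarrow> real"
  shows "(\<Sum>t=1..T. f (pulled \<omega> t)) = (\<Sum>a<K. f a * pulls \<omega> T a)"
proof -
  have "(\<Sum>a<K. f a * pulls \<omega> T a) = (\<Sum>a<K. \<Sum>t | t \<in> {1..T} \<and> pulled \<omega> t = a. f (pulled \<omega> t))"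
    by (intro sum.cong) (auto simp: pulls_def)
  also have "\<dots> = (\<Sum>t=1..T. f (pulled \<omega> t))"
    by (intro sum.group) (auto intro: pulled_arm_less)
  finally show ?thesis ..
qed

lemma sum_pulls: "(\<Sum>a<K. real (pulls \<omega> T a)) = real T"
  using sum_over_rounds[of "\<lambda>_. 1" \<omega> T] by simp

lemma L_mono:
  assumes "1 \<le> \<tau>" "\<tau> \<le> \<tau>'" "1 \<le> m" "m \<le> m'"
  shows "L \<tau> m \<le> L \<tau>' m'"
proof -
  have "4 * real m * (real \<tau>)\<^sup>2 / \<beta> \<le> 4 * real m' * (real \<tau>')\<^sup>2 / \<beta>"
    using assms \<beta>_pos by (intro divide_right_mono mult_mono power_mono) auto
  then show ?thesis
    unfolding epoch_L_def using assms \<beta>_pos by (subst ln_le_cancel_iff) auto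
qed

text \<open>L is frozen at its value for the later epoch \<tau>' with all arms viable, so that the
  bounds on the epoch lengths form a geometric sequence.\<close>

lemma R_le:
  assumes "1 \<le> \<tau>" "\<tau> \<le> \<tau>'" "1 \<le> m" "m \<le> K"
  shows "R \<tau> m \<le> (u powr (1 / v) * 24 powr ((1 + v) / v) + 2) * L \<tau>' K / \<epsilon> * (2 powr ((1 + v) / v)) ^ \<tau>"
proof -
  define r c where "r = (2::real) powr ((1 + v) / v)" and "c = u powr (1 / v) * 24 powr ((1 + v) / v)"
  have L: "1 \<le> L \<tau> m" "L \<tau> m \<le> L \<tau>' K"
    using assms by (auto intro: L_ge_1 L_mono)
  have r: "1 \<le> r" unfolding r_def using v_pos by (intro ge_one_powr_ge_zero) auto
  \<comment> \<open>The rounding term 2 is absorbed, because L and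
    \<open>r ^ \<tau> / \<epsilon>\<close> are both at least 1.\<close>
  have "\<epsilon> \<le> r ^ \<tau>"
    using \<epsilon>_le one_le_power[OF r, of \<tau>] by linarith
  then have "1 * 1 \<le> L \<tau> m * (r ^ \<tau> / \<epsilon>)"
    using L \<epsilon>_pos by (intro mult_mono) (auto simp: le_divide_eq)
  then have "real (R \<tau> m) \<le> c * L \<tau> m * r ^ \<tau> / \<epsilon> + 2 * (L \<tau> m * (r ^ \<tau> / \<epsilon>))"
    using R_upper[OF assms(1,3)] by (simp add: r_def c_def)
  also have "\<dots> = (c + 2) * L \<tau> m * (r ^ \<tau> / \<epsilon>)"
    by (simp add: algebra_simps add_divide_distrib)
  also have "\<dots> \<le> (c + 2) * L \<tau>' K * (r ^ \<tau> / \<epsilon>)"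
    using L r \<epsilon>_pos by (intro mult_right_mono mult_left_mono) (auto simp: c_def)
  finally show ?thesis by (simp add: r_def c_def)
qed

text \<open>A pull of a after n completed epochs means that a has survived them, so n \<le> N.
  Epochs are counted in full, so cutting off the last one at the horizon only makes this an
  overcount.\<close>

lemma pulls_le:
  assumes good: "\<And>n. \<not> bad \<omega> n" and a: "a < K" "0 < gap K X a"
    and N: "\<And>n. n = 0 \<or> gap K X a \<le> 1 / 2 ^ n \<Longrightarrow> n \<le> N"
  shows "pulls \<omega> T a \<le> 2 * (u powr (1 / v) * 24 powr ((1 + v) / v) + 2) * L (Suc N) K / \<epsilon>
    * (2 powr ((1 + v) / v)) ^ Suc N"
proof -
  obtain b where b: "b < K" "gap K X b = 0" by (rule obtain_best_arm)
  define r where "r = (2::real) powr ((1 + v) / v)"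
  define c0 where "c0 = u powr (1 / v) * 24 powr ((1 + v) / v) + 2"
  define c where "c = c0 * L (Suc N) K / \<epsilon>"
  define S s where "S n = fst (state \<omega> n)" and "s n = snd (state \<omega> n)" for n
  define E where "E n = {t \<in> {s n<..s n + card (S n) * R (Suc n) (card (S n))}. cycle_arm (S n) (s n) t = a}" for n
  define I where "I = {n. n \<le> N \<and> a \<in> S n}"
  have S: "finite (S n)" "1 \<le> card (S n)" "card (S n) \<le> K" for n
    using viable_setsD[OF state_viable[of \<omega> n]] by (auto simp: S_def)
  have "{t \<in> {1..T}. pulled \<omega> t = a} \<subseteq> (\<Union>n\<in>I. E n)"
  proof
    fix t assume t: "t \<in> {t \<in> {1..T}. pulled \<omega> t = a}"
    define n where "n = epochs_before \<omega> t"
    have aS: "a \<in> S n"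
      using pulled_arm_viable[of \<omega> t] t by (simp add: S_def n_def)
    have bS: "b \<in> S n"
      using good_state[OF good b, of n] by (simp add: S_def)
    have "n = 0 \<or> gap K X a \<le> 1 / 2 ^ n"
      using good_state[OF good b, of n] aS by (auto simp: S_def)
    then have nI: "n \<in> I" using N aS by (simp add: I_def)
    \<comment> \<open>The best arm is viable as well and differs from a, so the pull lies within a
      proper epoch and not in the final phase.\<close>
    have "card (S n) \<noteq> 1"
      using aS bS a(2) b(2) by (metis card_1_singletonE singletonD less_irrefl)
    then have "t \<le> s n + card (S n) * R (Suc n) (card (S n))"
      using settled_epochs_before[of \<omega> t] snd_state_Suc[of \<omega> n]
      by (simp add: settled_def S_def s_def n_def del: epoch_state.simps)
    moreover have "s n < t"
      using snd_state_epochs_before[of t \<omega>] t by (simp add: s_def n_def)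
    moreover have "cycle_arm (S n) (s n) t = a"
      using t by (simp add: pulled_arm_eq S_def s_def n_def)
    ultimately show "t \<in> (\<Union>n\<in>I. E n)"
      using nI by (auto simp: E_def)
  qed
  then have "pulls \<omega> T a \<le> card (\<Union>n\<in>I. E n)"
    unfolding pulls_def by (intro card_mono) (auto simp: I_def E_def)
  also have "\<dots> \<le> (\<Sum>n\<in>I. card (E n))"
    by (rule card_UN_le) (simp add: I_def)
  also have "\<dots> = (\<Sum>n\<in>I. R (Suc n) (card (S n)))"
    unfolding E_def using S by (intro sum.cong card_cycle_rounds) (auto simp: I_def)
  finally have "real (pulls \<omega> T a) \<le> (\<Sum>n\<in>I. real (R (Suc n) (card (S n))))"
    by (simp flip: of_nat_sum)
  also have "\<dots> \<le> (\<Sum>n\<in>I. c * r ^ Suc n)"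
    unfolding c_def c0_def r_def using S by (intro sum_mono R_le) (auto simp: I_def)
  also have "\<dots> \<le> (\<Sum>n\<le>N. c * r ^ Suc n)"
    using L_ge_1[of "Suc N" K] K_pos \<epsilon>_pos by (intro sum_mono2) (auto simp: I_def c_def c0_def r_def)
  also have "\<dots> = c * (\<Sum>n\<le>N. r ^ Suc n)"
    by (simp add: sum_distrib_left)
  also have "\<dots> \<le> c * (2 * r ^ Suc N)"
  proof (intro mult_left_mono sum_powers_le)
    have "2 powr 1 \<le> r" unfolding r_def using v_pos by (intro powr_mono) (auto simp: field_simps)
    then show "2 \<le> r" by simp
  qed (use L_ge_1[of "Suc N" K] K_pos \<epsilon>_pos in \<open>auto simp: c_def c0_def\<close>)
  finally show ?thesis
    unfolding c0_def[symmetric] r_def[symmetric] by (simp add: c_def mult_ac)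
qed

lemma gap_mult_pulls_le:
  assumes T: "\<beta> = 1 / real T" "4 \<le> T" "K \<le> T"
    and good: "\<And>n. \<not> bad \<omega> n" and a: "a < K" "0 < gap K X a"
  shows "gap K X a * pulls \<omega> T a \<le>
    regret_const v u / \<epsilon> * ((ln T + loglog_gap (gap K X a)) * (1 / gap K X a) powr (1 / v))"
proof -
  define d where "d = gap K X a"
  define p where "p = (1 + v) / v"
  define r where "r = (2::real) powr p"
  define c where "c = u powr (1 / v) * 24 powr p + 2"
  define M where "M = 2 * (1 + u)"
  have d: "0 < d" "d \<le> M" using a gap_le[OF a(1)] by (simp_all add: d_def M_def)
  have M: "1 \<le> M" using u_pos by (simp add: M_def)
  have p: "0 < p" "p = 1 + 1 / v" using v_pos by (auto simp: p_def field_simps)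
  obtain N where N: "N = 0 \<or> d \<le> 1 / 2 ^ N" "\<forall>n. n = 0 \<or> d \<le> 1 / 2 ^ n \<longrightarrow> n \<le> N"
    by (rule obtain_last_epoch[OF d(1)])
  \<comment> \<open>For N = 0 this is d \<le> M; otherwise 2 ^ N \<le> 1 / d and M \<ge> 1.\<close>
  have "2 ^ N \<le> M / d"
  proof (cases "N = 0")
    case False
    with N(1) d have "2 ^ N * d \<le> 1" by (simp add: field_simps)
    then show ?thesis using M d by (simp add: le_divide_eq)
  qed (use d in simp)
  then have "(2 ^ N) powr p \<le> (M / d) powr p"
    using p by (intro powr_mono2) auto
  moreover have "r ^ N = (2 ^ N) powr p"
    by (simp add: r_def powr_power powr_powr mult.commute flip: powr_realpow)
  moreover have "(M / d) powr p = M powr p * ((1 / d) * (1 / d) powr (1 / v))"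
    using d M by (simp add: p(2) powr_divide powr_add field_simps)
  ultimately have rN: "r ^ N \<le> M powr p * ((1 / d) * (1 / d) powr (1 / v))" by simp
  have "L (Suc N) K = ln (4 * K * (Suc N)\<^sup>2 * T)"
    by (simp add: epoch_L_def T(1))
  also have "\<dots> = ln 4 + ln K + 2 * ln (Suc N) + ln T"
    using K_pos T(2) by (simp add: ln_mult ln_realpow)
  \<comment> \<open>One ln T each for ln 4, ln K and ln T itself, and two for the 2 ln 3 from the
    number of epochs.\<close>
  also have "\<dots> \<le> 5 * ln T + 2 * loglog_gap d"
  proof -
    have "ln 4 \<le> ln (real T)" "ln (real K) \<le> ln T" "ln 3 \<le> ln (real T)"
      using T(2,3) K_pos by (simp_all)
    then show ?thesis using ln_epochs_le[OF d(1) N(1)] by linarith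
  qed
  also have "\<dots> \<le> 5 * (ln T + loglog_gap d)"
    using loglog_gap_nonneg[of d] by simp
  finally have L: "L (Suc N) K \<le> 5 * (ln T + loglog_gap d)" .
  have L0: "0 \<le> L (Suc N) K"
    using L_ge_1[of "Suc N" K] K_pos by simp
  have c: "0 \<le> c" by (simp add: c_def)
  have "pulls \<omega> T a \<le> 2 * c * L (Suc N) K / \<epsilon> * r ^ Suc N"
    using pulls_le[OF good a, of N T] N(2) by (simp add: c_def r_def p_def d_def)
  also have "\<dots> = 2 * c * r / \<epsilon> * (L (Suc N) K * r ^ N)"
    by simp
  also have "\<dots> \<le> 2 * c * r / \<epsilon> * (5 * (ln T + loglog_gap d) * (M powr p * ((1 / d) * (1 / d) powr (1 / v))))"
    using L rN L0 c \<epsilon>_pos by (intro mult_left_mono mult_mono) (auto simp: r_def)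
  finally have "d * pulls \<omega> T a \<le>
      d * (2 * c * r / \<epsilon> * (5 * (ln T + loglog_gap d) * (M powr p * ((1 / d) * (1 / d) powr (1 / v)))))"
    using d by (intro mult_left_mono) auto
  \<comment> \<open>The factor d cancels one 1 / d: as p = 1 + 1 / v, the exponent 1 / v is
    left.\<close>
  also have "\<dots> = 10 * c * r * M powr p / \<epsilon> * ((ln T + loglog_gap d) * (1 / d) powr (1 / v))"
    using d by simp
  finally show ?thesis
    by (simp add: d_def regret_const_def c_def r_def p_def M_def)
qed

section \<open>From pull counts to regret\<close>

lemma expected_regret_le:
  assumes T: "\<beta> = 1 / real T" "1 \<le> T"
    and G: "0 \<le> G" "\<And>\<omega>. (\<And>n. \<not> bad \<omega> n) \<Longrightarrow> (\<Sum>a<K. gap K X a * pulls \<omega> T a) \<le> G"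
  shows "expected_regret K v u \<epsilon> \<beta> X T \<le> G + 3 * Max (gap K X ` {..<K})"
proof -
  define D where "D = Max (gap K X ` {..<K})"
  define E where "E = {\<omega> \<in> space \<Omega>. \<exists>n. bad \<omega> n}"
  have gapD: "gap K X a \<le> D" if "a < K" for a
    using that unfolding D_def by (intro Max_ge) auto
  have D: "0 \<le> D"
    using gapD[OF K_pos] gap_nonneg[OF K_pos] by simp
  have [measurable]: "E \<in> events" unfolding E_def by (rule events_ever_bad)
  have le: "(\<Sum>t=1..T. gap K X (pulled \<omega> t)) \<le> G + T * D * indicator E \<omega>" if "\<omega> \<in> space \<Omega>" for \<omega>
  proof (cases "\<omega> \<in> E")
    case False
    with that have "(\<Sum>a<K. gap K X a * pulls \<omega> T a) \<le> G"
      by (intro G(2)) (auto simp: E_def)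
    with False show ?thesis unfolding sum_over_rounds by simp
  next
    case True
    have "(\<Sum>t=1..T. gap K X (pulled \<omega> t)) \<le> (\<Sum>t=1..T. D)"
      by (intro sum_mono gapD pulled_arm_less)
    with True G(1) show ?thesis by simp
  qed
  have "expected_regret K v u \<epsilon> \<beta> X T = expectation (\<lambda>\<omega>. \<Sum>t=1..T. gap K X (pulled \<omega> t))"
    by (rule expected_regret_eq)
  also have "\<dots> \<le> expectation (\<lambda>\<omega>. G + T * D * indicator E \<omega>)"
    using le by (intro integral_mono Bochner_Integration.integrable_sum integrable_gap
      Bochner_Integration.integrable_add integrable_mult_right integrable_real_indicator) (auto simp: emeasure_eq_measure)
  also have "\<dots> = G + T * D * prob E"
    by (subst Bochner_Integration.integral_add) (auto simp: prob_space emeasure_eq_measure)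
  \<comment> \<open>On the bad event each of the T rounds costs at most D; with \<beta> = 1 / T the
    horizon cancels.\<close>
  also have "\<dots> \<le> G + T * D * (3 * \<beta>)"
    using prob_ever_bad D by (intro add_left_mono mult_left_mono) (auto simp: E_def)
  also have "\<dots> = G + 3 * D"
    using T by simp
  finally show ?thesis by (simp add: D_def)
qed

lemma instance_dependent_bound:
  assumes T: "\<beta> = 1 / real T" "4 \<le> T" "K \<le> T"
  shows "expected_regret K v u \<epsilon> \<beta> X T \<le>
    regret_const v u / \<epsilon> * (\<Sum>a | a < K \<and> gap K X a > 0.
      (ln T + loglog_gap (gap K X a)) * (1 / gap K X a) powr (1 / v)) + 3 * Max (gap K X ` {..<K})"
proof (rule expected_regret_le)
  let ?f = "\<lambda>a. (ln T + loglog_gap (gap K X a)) * (1 / gap K X a) powr (1 / v)"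
  let ?I = "{a. a < K \<and> gap K X a > 0}"
  have f: "0 \<le> ?f a" for a
    using T(2) loglog_gap_nonneg[of "gap K X a"] by simp
  have "0 \<le> sum ?f ?I" by (rule sum_nonneg) (rule f)
  then show "0 \<le> regret_const v u / \<epsilon> * sum ?f ?I"
    using \<epsilon>_pos regret_const_pos[OF u_pos, of v] by simp
  fix \<omega> assume good: "\<And>n. \<not> bad \<omega> n"
  have "(\<Sum>a<K. gap K X a * pulls \<omega> T a) = (\<Sum>a\<in>?I. gap K X a * pulls \<omega> T a)"
    using gap_nonneg by (intro sum.mono_neutral_right) (auto simp: not_less intro: antisym)
  also have "\<dots> \<le> (\<Sum>a\<in>?I. regret_const v u / \<epsilon> * ?f a)"
    using gap_mult_pulls_le[OF T good] by (intro sum_mono) auto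
  finally show "(\<Sum>a<K. gap K X a * pulls \<omega> T a) \<le> regret_const v u / \<epsilon> * sum ?f ?I"
    by (simp add: sum_distrib_left)
qed (use T in auto)

lemma instance_independent_bound:
  assumes T: "\<beta> = 1 / real T" "4 \<le> T" "K \<le> T"
  shows "expected_regret K v u \<epsilon> \<beta> X T \<le> (1 + 2 * regret_const v u + 6 * (1 + u)) *
    ((real K * ln T / \<epsilon>) powr (v / (1 + v)) * T powr (1 / (1 + v)))"
proof -
  define c where "c = regret_const v u"
  define H where "H = real K * ln T / \<epsilon>"
  define q where "q = v / (1 + v)"
  define W where "W = H powr q * T powr (1 / (1 + v))"
  \<comment> \<open>This value equalises the two contributions: T \<theta> from arms of small gap
    and, up to a constant, \<open>H * (1 / \<theta>) powr (1 / v)\<close> from the others. Both are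
    equal to W.\<close>
  define \<theta> where "\<theta> = (H / T) powr q"
  have c: "0 < c" unfolding c_def by (rule regret_const_pos[OF u_pos])
  have q: "0 \<le> q" "q \<le> 1" "1 - q = 1 / (1 + v)"
    using v_pos by (auto simp: q_def field_simps)
  have qv: "q / v = 1 / (1 + v)"
    using v_pos by (simp add: q_def)
  have T0: "0 < real T" "1 \<le> real T" using T(2) by auto
  have eT: "exp 1 \<le> real T" using exp_le T(2) by linarith
  have lnT: "1 \<le> ln T"
    using eT T0 by (simp add: ln_ge_iff)
  have "1 * 1 \<le> real K * ln T"
    using K_pos lnT by (intro mult_mono) auto
  then have H: "1 \<le> H"
    using \<epsilon>_pos \<epsilon>_le by (simp add: H_def le_divide_eq)
  have W1: "1 \<le> W"
    using mult_mono[of 1 "H powr q" 1 "T powr (1 / (1 + v))"] H T0 q v_pos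
    by (simp add: W_def ge_one_powr_ge_zero)
  \<comment> \<open>Ensures 1 / gap \<le> T for gaps above \<theta>, so that their iterated
    logarithm is at most ln T.\<close>
  have "1 / T \<le> (1 / T) powr q"
    using powr_mono'[of q 1 "1 / T"] T0 q by simp
  also have "\<dots> \<le> \<theta>"
    unfolding \<theta>_def using H T0 q by (intro powr_mono2 divide_right_mono) auto
  finally have \<theta>: "1 / T \<le> \<theta>" "0 < \<theta>"
    using T0 by (auto intro: less_le_trans[of _ "1 / T"])
  have T\<theta>: "T * \<theta> = W"
  proof -
    have "T * \<theta> = H powr q * (T powr 1 / T powr q)"
      using T0 H by (simp add: \<theta>_def powr_divide)
    also have "T powr 1 / T powr q = T powr (1 / (1 + v))"
      by (simp only: powr_diff flip: q(3))
    also have "H powr q * \<dots> = W" by (simp add: W_def)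
    finally show ?thesis .
  qed
  have H\<theta>: "H * (1 / \<theta>) powr (1 / v) = W"
  proof -
    have "(1 / \<theta>) powr (1 / v) = 1 / (H / T) powr (1 / (1 + v))"
      using T0 H by (simp add: \<theta>_def powr_divide powr_powr qv)
    then have "H * (1 / \<theta>) powr (1 / v) = (H powr 1 / H powr (1 / (1 + v))) * T powr (1 / (1 + v))"
      using T0 H by (simp add: powr_divide)
    also have "\<dots> = H powr (1 - 1 / (1 + v)) * T powr (1 / (1 + v))"
      by (simp only: powr_diff)
    also have "1 - 1 / (1 + v) = q" using q(3) by linarith
    finally show ?thesis by (simp add: W_def)
  qed
  have "expected_regret K v u \<epsilon> \<beta> X T \<le> (W + 2 * c * W) + 3 * Max (gap K X ` {..<K})"
  proof (rule expected_regret_le)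
    fix \<omega> assume good: "\<And>n. \<not> bad \<omega> n"
    define D where "D = c / \<epsilon> * (2 * ln T * (1 / \<theta>) powr (1 / v))"
    have D: "0 \<le> D" using c \<epsilon>_pos lnT by (simp add: D_def)
    \<comment> \<open>One inequality for both kinds of arms: summed over the arms, the first term
      gives T \<theta>, as there are T pulls altogether, and the second gives K D.\<close>
    have "gap K X a * pulls \<omega> T a \<le> \<theta> * pulls \<omega> T a + D" if a: "a < K" for a
    proof (cases "gap K X a \<le> \<theta>")
      case True
      then have "gap K X a * pulls \<omega> T a \<le> \<theta> * pulls \<omega> T a"
        by (intro mult_right_mono) auto
      with D show ?thesis by simp
    next
      case False
      then have d: "0 < gap K X a" "\<theta> \<le> gap K X a" using \<theta> by auto
      have inv: "1 / gap K X a \<le> 1 / \<theta>" "1 / \<theta> \<le> T"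
        using d \<theta> T0 by (auto simp: field_simps)
      have "loglog_gap (gap K X a) \<le> ln (ln (max (exp 1) T))"
      proof -
        have "ln (exp 1) \<le> ln (max (exp 1) (1 / gap K X a))"
          by (subst ln_le_cancel_iff) (auto simp: less_max_iff_disj)
        moreover have "ln (max (exp 1) (1 / gap K X a)) \<le> ln (max (exp 1) T)"
          using inv by (subst ln_le_cancel_iff) (auto simp: less_max_iff_disj intro: max.mono)
        ultimately show ?thesis
          unfolding loglog_gap_def by (subst ln_le_cancel_iff) auto
      qed
      also have "\<dots> \<le> ln T"
        using eT lnT ln_le_minus_one[of "ln T"] by (simp add: max_absorb2)
      finally have "ln T + loglog_gap (gap K X a) \<le> 2 * ln T" by simp
      moreover have "(1 / gap K X a) powr (1 / v) \<le> (1 / \<theta>) powr (1 / v)"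
        using inv d v_pos by (intro powr_mono2) auto
      ultimately have "(ln T + loglog_gap (gap K X a)) * (1 / gap K X a) powr (1 / v) \<le> 2 * ln T * (1 / \<theta>) powr (1 / v)"
        using lnT by (intro mult_mono) auto
      then have "c / \<epsilon> * ((ln T + loglog_gap (gap K X a)) * (1 / gap K X a) powr (1 / v)) \<le> D"
        unfolding D_def using c \<epsilon>_pos by (intro mult_left_mono) auto
      moreover have "gap K X a * pulls \<omega> T a \<le>
          c / \<epsilon> * ((ln T + loglog_gap (gap K X a)) * (1 / gap K X a) powr (1 / v))"
        using gap_mult_pulls_le[OF T good a d(1)] by (simp add: c_def)
      moreover have "0 \<le> \<theta> * pulls \<omega> T a" using \<theta> by simp
      ultimately show ?thesis by linarith
    qed
    then have "(\<Sum>a<K. gap K X a * pulls \<omega> T a) \<le> (\<Sum>a<K. \<theta> * pulls \<omega> T a + D)"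
      by (intro sum_mono) auto
    also have "\<dots> = T * \<theta> + K * D"
      by (simp add: sum.distrib sum_pulls mult.commute flip: sum_distrib_left)
    also have "K * D = 2 * c * (H * (1 / \<theta>) powr (1 / v))"
      by (simp add: D_def H_def)
    finally show "(\<Sum>a<K. gap K X a * pulls \<omega> T a) \<le> W + 2 * c * W"
      unfolding T\<theta> H\<theta> .
  qed (use T W1 c in auto)
  \<comment> \<open>The largest gap is bounded in terms of u alone, and W \<ge> 1 absorbs
    it.\<close>
  also have "Max (gap K X ` {..<K}) \<le> 2 * (1 + u)"
    using K_pos gap_le by (subst Max_le_iff) auto
  also have "(W + 2 * c * W) + 3 * (2 * (1 + u)) \<le> (W + 2 * c * W) + 3 * (2 * (1 + u)) * W"
    using W1 u_pos by (intro add_left_mono) (simp add: mult_left_le_one_le)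
  finally show ?thesis
    by (simp add: W_def H_def q_def c_def algebra_simps)
qed

end

theorem theorem4:
  fixes v u :: real
  assumes "0 < v" and "v \<le> 1" and "0 < u"
  shows "\<exists>C>0. \<forall>K\<ge>2. \<exists>T0::nat. \<forall>(\<epsilon>::real) (T::nat) X.
           0 < \<epsilon> \<longrightarrow> \<epsilon> \<le> 1 \<longrightarrow> T0 \<le> T \<longrightarrow> heavy_tailed_bandit K v u X \<longrightarrow>
             expected_regret K v u \<epsilon> (1 / real T) X T
               \<le> C * (u powr (1 / (1 + v)) / \<epsilon> *
                        (\<Sum>a | a < K \<and> gap K X a > 0.
                           (ln (real T) + loglog_gap (gap K X a)) * (1 / gap K X a) powr (1 / v))
                      + Max (gap K X ` {..<K})) \<and>
             expected_regret K v u \<epsilon> (1 / real T) X T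
               \<le> C * u powr (v / (1 + v)\<^sup>2) * (real K * ln (real T) / \<epsilon>) powr (v / (1 + v))
                   * real T powr (1 / (1 + v))"
proof -
  define c c1 c2 where "c = regret_const v u" and "c1 = u powr (1 / (1 + v))" and "c2 = u powr (v / (1 + v)\<^sup>2)"
  define c' where "c' = 1 + 2 * c + 6 * (1 + u)"
  \<comment> \<open>The divisions compensate for the powers of u displayed in the two bounds; 3 is
    the factor of the largest gap.\<close>
  define C where "C = c / c1 + 3 + c' / c2"
  have pos: "0 < c" "0 < c1" "0 < c2" "0 < c'"
    using assms regret_const_pos[of u v] by (auto simp: c_def c1_def c2_def c'_def)
  have "0 < c / c1" "0 < c' / c2" using pos by simp_all
  then have C: "0 < C" "c / c1 \<le> C" "3 \<le> C" "c' / c2 \<le> C"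
    unfolding C_def by linarith+
  then have C': "c \<le> C * c1" "c' \<le> C * c2"
    using pos by (simp_all add: divide_le_eq)
  show ?thesis
  proof (intro exI[of _ C] conjI allI impI C(1))
    fix K :: nat assume K: "2 \<le> K"
    show "\<exists>T0::nat. \<forall>\<epsilon> T X. 0 < \<epsilon> \<longrightarrow> \<epsilon> \<le> 1 \<longrightarrow> T0 \<le> T \<longrightarrow> heavy_tailed_bandit K v u X \<longrightarrow>
             expected_regret K v u \<epsilon> (1 / real T) X T
               \<le> C * (u powr (1 / (1 + v)) / \<epsilon> *
                        (\<Sum>a | a < K \<and> gap K X a > 0.
                           (ln (real T) + loglog_gap (gap K X a)) * (1 / gap K X a) powr (1 / v))
                      + Max (gap K X ` {..<K})) \<and>
             expected_regret K v u \<epsilon> (1 / real T) X T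
               \<le> C * u powr (v / (1 + v)\<^sup>2) * (real K * ln (real T) / \<epsilon>) powr (v / (1 + v))
                   * real T powr (1 / (1 + v))"
    \<comment> \<open>With this threshold ln 3, ln 4 and ln K are all at most ln T.\<close>
    proof (intro exI[of _ "max 4 K"] allI impI)
      fix \<epsilon> :: real and T :: nat and X
      assume \<epsilon>: "0 < \<epsilon>" "\<epsilon> \<le> 1" and T: "max 4 K \<le> T" and X: "heavy_tailed_bandit K v u X"
      interpret dp_rse K v u \<epsilon> "1 / real T" X
        using assms K \<epsilon> T X by unfold_locales auto
      have T': "4 \<le> T" "K \<le> T" using T by auto
      define A where "A = (\<Sum>a | a < K \<and> gap K X a > 0.
        (ln (real T) + loglog_gap (gap K X a)) * (1 / gap K X a) powr (1 / v))"
      define D where "D = Max (gap K X ` {..<K})"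
      define W where "W = (real K * ln T / \<epsilon>) powr (v / (1 + v)) * T powr (1 / (1 + v))"
      have A: "0 \<le> A"
        unfolding A_def using T' loglog_gap_nonneg by (intro sum_nonneg mult_nonneg_nonneg add_nonneg_nonneg) auto
      have "gap K X 0 \<le> D" unfolding D_def using K by (intro Max_ge) auto
      then have D: "0 \<le> D" using gap_nonneg[of 0] K by simp
      have "expected_regret K v u \<epsilon> (1 / real T) X T \<le> c * (A / \<epsilon>) + 3 * D"
        using instance_dependent_bound[OF refl T'] by (simp add: A_def D_def c_def)
      also have "\<dots> \<le> (C * c1) * (A / \<epsilon>) + C * D"
        using C C' A D \<epsilon> by (intro add_mono mult_right_mono) auto
      finally have 1: "expected_regret K v u \<epsilon> (1 / real T) X T \<le> C * (c1 / \<epsilon> * A + D)"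
        by (simp add: algebra_simps)
      have "expected_regret K v u \<epsilon> (1 / real T) X T \<le> c' * W"
        using instance_independent_bound[OF refl T'] by (simp add: W_def c'_def c_def)
      also have "\<dots> \<le> (C * c2) * W"
        using C' by (intro mult_right_mono) (auto simp: W_def)
      finally have 2: "expected_regret K v u \<epsilon> (1 / real T) X T \<le> C * c2 * W" .
      show "expected_regret K v u \<epsilon> (1 / real T) X T
               \<le> C * (u powr (1 / (1 + v)) / \<epsilon> *
                        (\<Sum>a | a < K \<and> gap K X a > 0.
                           (ln (real T) + loglog_gap (gap K X a)) * (1 / gap K X a) powr (1 / v))
                      + Max (gap K X ` {..<K})) \<and>
             expected_regret K v u \<epsilon> (1 / real T) X T
               \<le> C * u powr (v / (1 + v)\<^sup>2) * (real K * ln (real T) / \<epsilon>) powr (v / (1 + v))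
                   * real T powr (1 / (1 + v))"
        using 1 2 by (simp add: A_def D_def W_def c1_def c2_def mult.assoc)
    qed
  qed
qed

end
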